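(* Let $\mu_1>\lambda>\mu_2>0$, and let $d_1^*=d_1^*(\lambda,\mu_1,\mu_2)$ be the smallest integer $d\ge 2$ satisfying both $$d\,\lambda \left( \frac{1}{\mu_2} - \frac{1}{\mu_1} \right) > 1 \quad\text{and}\quad \left(1- \frac{1}{d}\right) \frac{\mu_1}{\lambda} > \left( d\,\lambda \left( \frac{1}{\mu_2} - \frac{1}{\mu_1}\right) \right)^{\frac{1}{d-1}}.$$ Let $d_1\ge d_1^*$ be an integer. Then the system of differential equations (FL) given in the context has precisely two fixed points with $q_{00}>0$; they satisfy $q_{00}+q_{01}+q_{10}=1$. Of these two fixed points, one is locally stable and the other one is unstable.
   Context: **State space.** States are families $(q_{ij})_{i\ge 0,\ j\in\{0,1\}}$ with $q_{ij}\ge 0$ and $\sum_{i,j}q_{ij}=1$, with the $\ell^1$ distance. Equivalently, a state is described by the tail sums $\overline{q}_{ij}=\sum_{k\ge i}q_{kj}$, so that $q_{ij}=\overline q_{ij}-\overline q_{i+1,j}$ and $\overline q_{00}+\overline q_{01}=1$. **System (FL).** With $x^+=\max(x,0)$, put $\tilde\lambda=(\lambda-\mu_1q_{10}-\mu_2q_{01})^+$. The equations are $$\begin{aligned} \tfrac{d}{dt}\overline q_{00}&=\mu_2(\overline q_{01}-\overline q_{11})-\lambda(1-q_{00})^{d_1}+\tilde\lambda\,\mathbf 1\{q_{00}=0\},\\ \tfrac{d}{dt}\overline q_{01}&=\mu_2(\overline q_{11}-\overline q_{01})+\mathbf 1\{q_{00}>0\}\,\lambda(1-q_{00})^{d_1}+\mathbf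 1\{q_{00}=0\}\,[\lambda-\tilde\lambda],\\ \tfrac{d}{dt}\overline q_{10}&=\mu_1(\overline q_{20}-\overline q_{10})+\mathbf 1\{q_{00}>0\}\,\lambda\left(1-(1-q_{00})^{d_1}\right),\\ \tfrac{d}{dt}\overline q_{11}&=\mu_1(\overline q_{21}-\overline q_{11})+\tilde\lambda\,\mathbf 1\{q_{00}=0\}\left[(\overline q_{10}+\overline q_{01})^{d_1}-(\overline q_{10}+\overline q_{11})^{d_1}\right], \end{aligned}$$ and for $i\ge 2$ $$\begin{aligned} \tfrac{d}{dt}\overline q_{i0}&=\mu_1(\overline q_{i+1,0}-\overline q_{i0})+\tilde\lambda\,\mathbf 1\{q_{00}=0\}\left[(\overline q_{i-1,0}+\overline q_{i-1,1})^{d_1}-(\overline q_{i0}+\overline q_{i-1,1})^{d_1}\right],\\ \tfrac{d}{dt}\overline q_{i1}&=\mu_1(\overline q_{i+1,1}-\overline q_{i1})+\tilde\lambda\,\mathbf 1\{q_{00}=0\}\left[(\overline q_{i0}+\overline q_{i-1,1})^{d_1}-(\overline q_{i0}+\overline q_{i1})^{d_1}\right]. \end{aligned}$$ **Fixed points and stability.** A fixed point of (FL) is a state at which all right-hand sides vanish. Near a fixed point with $q_{00}>0$ the right-hand sides are smooth, so stability concerns the ordinary dynamics in the region $q_{00}>0$. A fixed point $q^*$ with $q_{00}^*>0$ is *locally stable* if for every $\varepsilon>0$ there is $\delta>0$ such that solutions of (FL) starting at $\ell^1$-distance less than $\delta$ from $q^*$ stay at distance less than $\varepsilon$ for all $t\ge0$,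 and all solutions starting sufficiently close to $q^*$ converge to $q^*$ as $t\to\infty$. It is *unstable* if there is $\varepsilon>0$ such that arbitrarily close to $q^*$ there are initial states whose solutions reach distance at least $\varepsilon$ from $q^*$. *)

theory Defs
  imports "HOL-Analysis.Analysis"
begin

text \<open>
  The second index of a family \<open>q\<^sub>i\<^sub>j\<close> ranges over the two-element type \<open>2\<close>, whose elements are
  \<open>0\<close> and \<open>1\<close>.
\<close>

type_synonym family = "nat \<Rightarrow> 2 \<Rightarrow> real"

definition is_state :: "family \<Rightarrow> bool" where
  "is_state q \<longleftrightarrow> (\<forall>i j. 0 \<le> q i j) \<and> ((\<lambda>(i, j). q i j) has_sum 1) UNIV"

definition l1_dist :: "family \<Rightarrow> family \<Rightarrow> real" where
  "l1_dist p q = (\<Sum>\<^sub>\<infinity>(i, j)\<in>UNIV. \<bar>p i j - q i j\<bar>)"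

definition tail :: "family \<Rightarrow> family" where
  "tail q i j = (\<Sum>\<^sub>\<infinity>k\<in>{i..}. q k j)"

definition lam_tilde :: "real \<Rightarrow> real \<Rightarrow> real \<Rightarrow> family \<Rightarrow> real" where
  "lam_tilde lam \<mu>\<^sub>1 \<mu>\<^sub>2 q = max (lam - \<mu>\<^sub>1 * q 1 0 - \<mu>\<^sub>2 * q 0 1) 0"

text \<open>
  \<open>FL_rhs lam \<mu>\<^sub>1 \<mu>\<^sub>2 d\<^sub>1 q i j\<close> is the right-hand side of the equation for the derivative of the
  tail sum \<open>tail q i j\<close> (not of \<open>q i j\<close>).
\<close>

definition FL_rhs :: "real \<Rightarrow> real \<Rightarrow> real \<Rightarrow> nat \<Rightarrow> family \<Rightarrow> nat \<Rightarrow> 2 \<Rightarrow> real" where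
  "FL_rhs lam \<mu>\<^sub>1 \<mu>\<^sub>2 d\<^sub>1 q i j =
    (let Q = tail q;
         lt = lam_tilde lam \<mu>\<^sub>1 \<mu>\<^sub>2 q;
         idle = of_bool (q 0 0 > 0);
         busy = of_bool (q 0 0 = 0)
     in
      if i = 0 then
        (if j = 0 then
           \<mu>\<^sub>2 * (Q 0 1 - Q 1 1) - lam * (1 - q 0 0) ^ d\<^sub>1 + lt * busy
         else
           \<mu>\<^sub>2 * (Q 1 1 - Q 0 1) + idle * lam * (1 - q 0 0) ^ d\<^sub>1 + busy * (lam - lt))
      else if i = 1 then
        (if j = 0 then
           \<mu>\<^sub>1 * (Q 2 0 - Q 1 0) + idle * lam * (1 - (1 - q 0 0) ^ d\<^sub>1)
         else
           \<mu>\<^sub>1 * (Q 2 1 - Q 1 1)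
             + lt * busy * ((Q 1 0 + Q 0 1) ^ d\<^sub>1 - (Q 1 0 + Q 1 1) ^ d\<^sub>1))
      else
        (if j = 0 then
           \<mu>\<^sub>1 * (Q (i + 1) 0 - Q i 0)
             + lt * busy * ((Q (i - 1) 0 + Q (i - 1) 1) ^ d\<^sub>1 - (Q i 0 + Q (i - 1) 1) ^ d\<^sub>1)
         else
           \<mu>\<^sub>1 * (Q (i + 1) 1 - Q i 1)
             + lt * busy * ((Q i 0 + Q (i - 1) 1) ^ d\<^sub>1 - (Q i 0 + Q i 1) ^ d\<^sub>1)))"

definition FL_fixed_point :: "real \<Rightarrow> real \<Rightarrow> real \<Rightarrow> nat \<Rightarrow> family \<Rightarrow> bool" where
  "FL_fixed_point lam \<mu>\<^sub>1 \<mu>\<^sub>2 d\<^sub>1 q \<longleftrightarrow>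
     is_state q \<and> (\<forall>i j. FL_rhs lam \<mu>\<^sub>1 \<mu>\<^sub>2 d\<^sub>1 q i j = 0)"

text \<open>
  Solutions are classical: every tail sum is differentiable on the time interval \<open>S\<close> (one-sidedly
  at end points belonging to \<open>S\<close>), and the state constraint holds throughout.
  The right-hand sides are continuous where \<open>q\<^sub>0\<^sub>0 > 0\<close>, so in that region this agrees with the
  integrated form of the equations.
\<close>

definition FL_solution ::
  "real \<Rightarrow> real \<Rightarrow> real \<Rightarrow> nat \<Rightarrow> real set \<Rightarrow> (real \<Rightarrow> family) \<Rightarrow> bool" where
  "FL_solution lam \<mu>\<^sub>1 \<mu>\<^sub>2 d\<^sub>1 S q \<longleftrightarrow>
     (\<forall>t\<in>S. is_state (q t)) \<and>
     (\<forall>t\<in>S. \<forall>i j. ((\<lambda>s. tail (q s) i j) has_real_derivative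
        FL_rhs lam \<mu>\<^sub>1 \<mu>\<^sub>2 d\<^sub>1 (q t) i j) (at t within S))"

text \<open>
  In \<open>FL_locally_stable\<close> the first conjunct bounds all solutions started near \<open>p\<close>, including those
  given only up to a finite time; the second requires in addition that solutions started near \<open>p\<close>
  exist for all times, so that the convergence statement is not vacuous.
\<close>

definition FL_locally_stable :: "real \<Rightarrow> real \<Rightarrow> real \<Rightarrow> nat \<Rightarrow> family \<Rightarrow> bool" where
  "FL_locally_stable lam \<mu>\<^sub>1 \<mu>\<^sub>2 d\<^sub>1 p \<longleftrightarrow>
     (\<forall>\<epsilon>>0. \<exists>\<delta>>0. \<forall>T>0. \<forall>q.
        FL_solution lam \<mu>\<^sub>1 \<mu>\<^sub>2 d\<^sub>1 {0..<T} q \<and> l1_dist (q 0) p < \<delta> \<longrightarrow>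
        (\<forall>t\<in>{0..<T}. l1_dist (q t) p < \<epsilon>)) \<and>
     (\<exists>\<delta>>0. \<forall>q0. is_state q0 \<and> l1_dist q0 p < \<delta> \<longrightarrow>
        (\<exists>q. FL_solution lam \<mu>\<^sub>1 \<mu>\<^sub>2 d\<^sub>1 {0..} q \<and> q 0 = q0) \<and>
        (\<forall>q. FL_solution lam \<mu>\<^sub>1 \<mu>\<^sub>2 d\<^sub>1 {0..} q \<and> q 0 = q0 \<longrightarrow>
           ((\<lambda>t. l1_dist (q t) p) \<longlongrightarrow> 0) at_top))"

definition FL_unstable :: "real \<Rightarrow> real \<Rightarrow> real \<Rightarrow> nat \<Rightarrow> family \<Rightarrow> bool" where
  "FL_unstable lam \<mu>\<^sub>1 \<mu>\<^sub>2 d\<^sub>1 p \<longleftrightarrow>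
     (\<exists>\<epsilon>>0. \<forall>\<delta>>0. \<exists>T>0. \<exists>q.
        FL_solution lam \<mu>\<^sub>1 \<mu>\<^sub>2 d\<^sub>1 {0..T} q \<and> l1_dist (q 0) p < \<delta> \<and> l1_dist (q T) p \<ge> \<epsilon>)"

definition d1_star :: "real \<Rightarrow> real \<Rightarrow> real \<Rightarrow> nat" where
  "d1_star lam \<mu>\<^sub>1 \<mu>\<^sub>2 = (LEAST d::nat. d \<ge> 2 \<and>
     real d * lam * (1 / \<mu>\<^sub>2 - 1 / \<mu>\<^sub>1) > 1 \<and>
     (1 - 1 / real d) * (\<mu>\<^sub>1 / lam)
       > (real d * lam * (1 / \<mu>\<^sub>2 - 1 / \<mu>\<^sub>1)) powr (1 / (real d - 1)))"

end

theory Submission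
  imports Defs "HOL-Real_Asymp.Real_Asymp"
begin

text \<open>
  Where \<open>q\<^sub>0\<^sub>0 > 0\<close>, the tails \<open>tail q i 0\<close> with \<open>i \<ge> 2\<close> and \<open>tail q i 1\<close> with \<open>i \<ge> 1\<close> obey a
  linear triangular system of their own and die out. The remaining information is the pair
  \<open>u = 1 - q\<^sub>0\<^sub>0\<close>, \<open>V = tail q 0 1\<close>, which follows a planar cooperative system driven by these tails.
  Its equilibria are the roots in \<open>(0, 1)\<close> of the strictly convex
  polynomial \<open>lam * (1 / \<mu>\<^sub>2 - 1 / \<mu>\<^sub>1) * u ^ d - u + lam / \<mu>\<^sub>1\<close>; it is positive at \<open>0\<close> and \<open>1\<close>,
  and the condition defining \<open>d1_star\<close> says that its minimum is negative, so there are two roots.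
  The Jacobian determinant is a negative multiple of the derivative of the polynomial. At the lower
  root the linearization therefore admits a diagonal quadratic Lyapunov function, which absorbs the
  driving terms. At the upper root a positive left eigenvector of the linearization yields, by
  convexity of \<open>u ^ d\<close>, a functional that grows exponentially for the nonlinear system as well.
\<close>

section \<open>Differential inequalities\<close>

text \<open>Two features shape the argument. On the dying tails the linear operator is
  \<open>- \<mu>\<^sub>1\<close> times identity minus shift; its spectrum on summable families is a
  closed disk that touches 0, so there is no uniform exponential rate and linearized stability
  cannot be quoted. The tails therefore enter only as a forcing of the planar pair: along solutions
  they never increase, which gives stability, and each of them tends to 0, which gives convergence.
  Moreover, the right-hand sides jump where \<open>q 0 0 = 0\<close>, so every estimate must also
  show that \<open>u\<close> stays below 1; this is the purpose of the first exit times and of the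
  truncation of \<open>u\<close>. Both stability notions also demand that solutions exist. They are
  built by solving the tail system with Poisson averages, the planar system by a contraction
  argument, and reassembling a state from the tails. For instability one solution per \<delta>
  suffices, so all its decaying tails are taken to be 0.\<close>

lemma gronwall:
  fixes E :: "real \<Rightarrow> real"
  assumes "a \<le> b" and cont: "continuous_on {a..b} E"
    and deriv: "\<And>t. a < t \<Longrightarrow> t < b \<Longrightarrow> \<exists>D. (E has_real_derivative D) (at t) \<and> D \<le> k * (m - E t)"
  shows "E b - m \<le> (E a - m) * exp (- k * (b - a))"
proof -
  \<comment> \<open>Integrating factor. The sign of \<open>k\<close> is free: a positive rate gives
    relaxation, rate 0 gives monotonicity, and a negative rate applied to a negated functional gives
    growth.\<close>
  define F where "F = (\<lambda>t. (E t - m) * exp (k * t))"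
  have "F b \<le> F a"
  proof (rule DERIV_nonpos_imp_decreasing_open[OF \<open>a \<le> b\<close>])
    fix t assume "a < t" "t < b"
    then obtain D where D: "(E has_real_derivative D) (at t)" "D \<le> k * (m - E t)"
      using deriv by blast
    have "(F has_real_derivative (D - k * (m - E t)) * exp (k * t)) (at t)"
      unfolding F_def by (auto intro!: derivative_eq_intros D(1) simp: algebra_simps)
    moreover have "(D - k * (m - E t)) * exp (k * t) \<le> 0"
      using D(2) by (simp add: mult_nonpos_nonneg)
    ultimately show "\<exists>y. (F has_real_derivative y) (at t) \<and> y \<le> 0" by blast
  next
    show "continuous_on {a..b} F"
      unfolding F_def by (intro continuous_intros cont)
  qed
  then have "(E b - m) * exp (k * b) * exp (- k * b) \<le> (E a - m) * exp (k * a) * exp (- k * b)"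
    unfolding F_def by (intro mult_right_mono) auto
  moreover have "exp (k * b) * exp (- k * b) = 1" "exp (k * a) * exp (- k * b) = exp (- k * (b - a))"
    by (simp_all flip: exp_add add: algebra_simps)
  ultimately show ?thesis by (simp only: mult.assoc mult_1_right)
qed

text \<open>Relaxation passes on an upper limit: once \<open>g\<close> stays below a level, Gronwall
  brings \<open>E\<close> down to it exponentially. Hypothesis and conclusion have the same form,
  limsup at most \<open>m\<close>, so the lemma can be iterated along the chain of tails and then
  applied to the energy.\<close>

lemma relaxation_eventually_less:
  fixes E g :: "real \<Rightarrow> real"
  assumes "k > 0"
    and deriv: "\<And>t. t > t0 \<Longrightarrow> \<exists>D. (E has_real_derivative D) (at t) \<and> D \<le> k * (g t - E t)"
    and g: "\<And>e. e > m \<Longrightarrow> \<forall>\<^sub>F t in at_top. g t < e"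
    and "e > m"
  shows "\<forall>\<^sub>F t in at_top. E t < e"
proof -
  define e' where "e' = (m + e) / 2"
  have e': "m < e'" "e' < e" using \<open>e > m\<close> by (auto simp: e'_def)
  obtain T where T: "\<And>t. t \<ge> T \<Longrightarrow> g t < e'"
    using g[OF e'(1)] by (auto simp: eventually_at_top_linorder)
  define a where "a = max T (t0 + 1)"
  have bound: "E t \<le> e' + (E a - e') * exp (- k * (t - a))" if "t \<ge> a" for t
  proof -
    have "E t - e' \<le> (E a - e') * exp (- k * (t - a))"
    proof (rule gronwall[OF that])
      show "continuous_on {a..t} E"
      proof (rule continuous_at_imp_continuous_on, rule ballI)
        fix s assume "s \<in> {a..t}"
        then have "s > t0" by (auto simp: a_def)
        then show "isCont E s" using deriv DERIV_isCont by blast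
      qed
    next
      fix s assume s: "a < s" "s < t"
      then obtain D where D: "(E has_real_derivative D) (at s)" "D \<le> k * (g s - E s)"
        using deriv[of s] by (auto simp: a_def)
      have "g s \<le> e'" using T[of s] s by (auto simp: a_def)
      then have "k * (g s - E s) \<le> k * (e' - E s)" using \<open>k > 0\<close> by simp
      then show "\<exists>D. (E has_real_derivative D) (at s) \<and> D \<le> k * (e' - E s)"
        using D by force
    qed
    then show ?thesis by simp
  qed
  have "((\<lambda>t. e' + (E a - e') * exp (- k * (t - a))) \<longlongrightarrow> e' + (E a - e') * 0) at_top"
  proof (intro tendsto_intros)
    show "((\<lambda>t. exp (- k * (t - a))) \<longlongrightarrow> 0) at_top" using \<open>k > 0\<close> by real_asymp
  qed
  then have "\<forall>\<^sub>F t in at_top. e' + (E a - e') * exp (- k * (t - a)) < e"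
    using e' by (intro order_tendstoD) auto
  then show ?thesis
    using eventually_ge_at_top[of a]
  proof eventually_elim
    case (elim t)
    then show ?case using bound[of t] by linarith
  qed
qed

lemma at_within_interval:
  fixes t :: real
  assumes "a < t" "t < b" "{a..b} \<subseteq> S"
  shows "at t within S = at t"
proof (rule at_within_open_subset)
  show "t \<in> {a<..<b}" "{a<..<b} \<subseteq> S" using assms by auto
qed simp

text \<open>Since the set of times with \<open>e \<le> g t\<close> is closed, its infimum is
  attained. The exact value there either contradicts an estimate valid up to the exit (stability) or
  is the displacement sought (instability).\<close>

lemma first_exit:
  fixes g :: "real \<Rightarrow> real"
  assumes "0 \<le> T" "continuous_on {0..T} g" "g 0 < e" "e \<le> g T"
  obtains s where "0 < s" "s \<le> T" "g s = e" "\<And>t. 0 \<le> t \<Longrightarrow> t < s \<Longrightarrow> g t < e"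
proof -
  define A where "A = {t \<in> {0..T}. e \<le> g t}"
  have "closed A" unfolding A_def
    by (intro continuous_on_closed_Collect_le continuous_intros assms)
  moreover have "A \<noteq> {}" "bdd_below A" using assms by (auto simp: A_def intro!: bdd_belowI[of _ 0])
  ultimately have mem: "Inf A \<in> A" using closed_contains_Inf by blast
  have less: "g t < e" if "0 \<le> t" "t < Inf A" for t
    using cInf_lower[OF _ \<open>bdd_below A\<close>, of t] mem that by (force simp: A_def)
  have "0 < Inf A" using mem assms(3) unfolding A_def
    by (smt (verit) atLeastAtMost_iff mem_Collect_eq)
  have "g (Inf A) = e"
  proof (rule ccontr)
    assume "g (Inf A) \<noteq> e"
    then have "g (Inf A) > e" using mem by (auto simp: A_def)
    moreover have "{0..Inf A} \<subseteq> {0..T}" using mem by (auto simp: A_def)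
    then have "continuous_on {0..Inf A} g" by (rule continuous_on_subset[OF assms(2)])
    ultimately obtain x where x: "0 \<le> x" "x \<le> Inf A" "g x = e"
      using IVT'[of g 0 e "Inf A"] assms(3) \<open>0 < Inf A\<close> by force
    then show False using less[of x] \<open>g (Inf A) \<noteq> e\<close> by (cases "x = Inf A") auto
  qed
  then show ?thesis using that[of "Inf A"] less mem \<open>0 < Inf A\<close> by (auto simp: A_def)
qed

text \<open>
  The matrix of the linear part is symmetrized by the weights \<open>c\<close>, \<open>b\<close>, after which the
  condition \<open>b * c < p * r\<close> is exactly definiteness.
\<close>
lemma lyapunov_inequality:
  fixes p r b c :: real
  assumes "0 < r" "r \<le> p" "0 < b" "0 < c" "b * c < p * r"
  obtains k C where "k > 0" "C \<ge> 0"
    "\<And>x y n g h \<rho>. \<bar>n\<bar> \<le> c * \<bar>x\<bar> \<Longrightarrow> \<bar>g\<bar> \<le> p * \<rho> \<Longrightarrow> \<bar>h\<bar> \<le> r * \<rho> \<Longrightarrow>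
      2 * c * x * (- p * x + b * y + g) + 2 * b * y * (n - r * y + h)
        \<le> k * (C * \<rho>\<^sup>2 - (c * x\<^sup>2 + b * y\<^sup>2))"
proof -
  \<comment> \<open>\<open>\<theta>\<close> is the share of the form
    \<open>A * x\<^sup>2 + B * y\<^sup>2\<close> that the two cross terms consume;
    \<open>\<theta> < 1\<close> is the hypothesis \<open>b * c < p * r\<close>.\<close>
  define \<theta> where "\<theta> = sqrt (b * c / (p * r))"
  have "p > 0" using assms by simp
  have \<theta>: "0 < \<theta>" "\<theta> < 1" using assms \<open>p > 0\<close> by (auto simp: \<theta>_def)
  define A where "A = c * p"
  define B where "B = b * r"
  have pos: "A > 0" "B > 0" using assms \<open>p > 0\<close> by (auto simp: A_def B_def)
  have bc: "b * c = \<theta> * sqrt A * sqrt B"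
  proof -
    have "\<theta> * sqrt A * sqrt B = sqrt (b * c / (p * r) * (c * p) * (b * r))"
      unfolding \<theta>_def A_def B_def by (simp only: real_sqrt_mult)
    also have "b * c / (p * r) * (c * p) * (b * r) = (b * c)\<^sup>2"
      using assms \<open>p > 0\<close> by (simp add: field_simps power2_eq_square)
    finally show ?thesis using assms by simp
  qed
  \<comment> \<open>The cross terms leave \<open>- 2 * s\<close> times the form. Young's inequality
    spends half of this on the forcing, and \<open>r \<le> p\<close> bounds the other half by
    \<open>s * r\<close> times the energy; hence \<open>k\<close> and \<open>C\<close>.\<close>
  define s where "s = 1 - \<theta>"
  have s: "0 < s" using \<theta> by (simp add: s_def)
  define k where "k = s * r"
  define C where "C = (A + B) / (s * k)"
  have "k > 0" "C \<ge> 0" using s assms pos by (auto simp: k_def C_def)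
  show ?thesis
  proof (rule that[OF \<open>k > 0\<close> \<open>C \<ge> 0\<close>])
    fix x y n g h \<rho> :: real
    assume n: "\<bar>n\<bar> \<le> c * \<bar>x\<bar>" and g: "\<bar>g\<bar> \<le> p * \<rho>" and h: "\<bar>h\<bar> \<le> r * \<rho>"
    have young: "2 * \<bar>z\<bar> * \<rho> \<le> s * z\<^sup>2 + \<rho>\<^sup>2 / s" for z
    proof -
      have "0 \<le> (s * \<bar>z\<bar> - \<rho>)\<^sup>2 / s" using s by simp
      also have "\<dots> = s * z\<^sup>2 + \<rho>\<^sup>2 / s - 2 * \<bar>z\<bar> * \<rho>"
        using s by (simp add: field_simps power2_eq_square)
      finally show ?thesis by simp
    qed
    have cross: "4 * (b * c) * \<bar>x\<bar> * \<bar>y\<bar> \<le> 2 * \<theta> * (A * x\<^sup>2 + B * y\<^sup>2)"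
    proof -
      have "0 \<le> 2 * \<theta> * (sqrt A * \<bar>x\<bar> - sqrt B * \<bar>y\<bar>)\<^sup>2" using \<theta> by simp
      also have "\<dots> = 2 * \<theta> * (A * x\<^sup>2 + B * y\<^sup>2) - 4 * (b * c) * \<bar>x\<bar> * \<bar>y\<bar>"
        using pos unfolding bc by (simp add: power2_diff power_mult_distrib algebra_simps)
      finally show ?thesis by simp
    qed
    have yn: "2 * b * y * n \<le> 2 * (b * c) * \<bar>x\<bar> * \<bar>y\<bar>"
    proof -
      have "y * n \<le> \<bar>y\<bar> * (c * \<bar>x\<bar>)"
        using mult_left_mono[OF n, of "\<bar>y\<bar>"] abs_le_iff[of "y * n" "\<bar>y\<bar> * (c * \<bar>x\<bar>)"]
        by (simp add: abs_mult)
      then have "(2 * b) * (y * n) \<le> (2 * b) * (\<bar>y\<bar> * (c * \<bar>x\<bar>))"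
        using assms by (intro mult_left_mono) auto
      then show ?thesis by (simp add: algebra_simps)
    qed
    have xy: "2 * c * x * (b * y) \<le> 2 * (b * c) * \<bar>x\<bar> * \<bar>y\<bar>"
    proof -
      have "x * y \<le> \<bar>x\<bar> * \<bar>y\<bar>" by (metis abs_ge_self abs_mult)
      then have "(2 * (b * c)) * (x * y) \<le> (2 * (b * c)) * (\<bar>x\<bar> * \<bar>y\<bar>)"
        using assms by (intro mult_left_mono) auto
      then show ?thesis by (simp add: algebra_simps)
    qed
    have xg: "2 * c * x * g \<le> A * (s * x\<^sup>2 + \<rho>\<^sup>2 / s)"
    proof -
      have "x * g \<le> \<bar>x\<bar> * (p * \<rho>)"
        using mult_left_mono[OF g, of "\<bar>x\<bar>"] abs_le_iff[of "x * g" "\<bar>x\<bar> * (p * \<rho>)"]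
        by (simp add: abs_mult)
      then have "(2 * c) * (x * g) \<le> (2 * c) * (\<bar>x\<bar> * (p * \<rho>))"
        using assms by (intro mult_left_mono) auto
      also have "\<dots> = A * (2 * \<bar>x\<bar> * \<rho>)" by (simp add: A_def)
      also have "\<dots> \<le> A * (s * x\<^sup>2 + \<rho>\<^sup>2 / s)" using young pos by (intro mult_left_mono) auto
      finally show ?thesis by simp
    qed
    have yh: "2 * b * y * h \<le> B * (s * y\<^sup>2 + \<rho>\<^sup>2 / s)"
    proof -
      have "y * h \<le> \<bar>y\<bar> * (r * \<rho>)"
        using mult_left_mono[OF h, of "\<bar>y\<bar>"] abs_le_iff[of "y * h" "\<bar>y\<bar> * (r * \<rho>)"]
        by (simp add: abs_mult)
      then have "(2 * b) * (y * h) \<le> (2 * b) * (\<bar>y\<bar> * (r * \<rho>))"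
        using assms by (intro mult_left_mono) auto
      also have "\<dots> = B * (2 * \<bar>y\<bar> * \<rho>)" by (simp add: B_def)
      also have "\<dots> \<le> B * (s * y\<^sup>2 + \<rho>\<^sup>2 / s)" using young pos by (intro mult_left_mono) auto
      finally show ?thesis by simp
    qed
    have "2 * c * x * (- p * x + b * y + g) + 2 * b * y * (n - r * y + h)
       = - 2 * (A * x\<^sup>2 + B * y\<^sup>2) + 2 * c * x * (b * y) + 2 * b * y * n + 2 * c * x * g + 2 * b * y * h"
      unfolding A_def B_def by (simp add: algebra_simps power2_eq_square)
    also have "\<dots> \<le> - 2 * (A * x\<^sup>2 + B * y\<^sup>2) + 2 * \<theta> * (A * x\<^sup>2 + B * y\<^sup>2)
        + A * (s * x\<^sup>2 + \<rho>\<^sup>2 / s) + B * (s * y\<^sup>2 + \<rho>\<^sup>2 / s)"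
      using cross xy yn xg yh by linarith
    also have "\<dots> = (A + B) / s * \<rho>\<^sup>2 - s * (A * x\<^sup>2 + B * y\<^sup>2)"
      using s by (simp add: s_def algebra_simps add_divide_distrib)
    also have "\<dots> \<le> (A + B) / s * \<rho>\<^sup>2 - s * (r * (c * x\<^sup>2) + r * (b * y\<^sup>2))"
    proof -
      have "r * (c * x\<^sup>2) \<le> A * x\<^sup>2" unfolding A_def using assms mult_right_mono[of r p "c * x\<^sup>2"] by (simp add: ac_simps)
      then have "s * (r * (c * x\<^sup>2) + r * (b * y\<^sup>2)) \<le> s * (A * x\<^sup>2 + B * y\<^sup>2)"
        using s by (intro mult_left_mono) (auto simp: B_def ac_simps)
      then show ?thesis by simp
    qed
    also have "\<dots> = k * (C * \<rho>\<^sup>2 - (c * x\<^sup>2 + b * y\<^sup>2))"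
    proof -
      have "k * C = (A + B) / s" using \<open>k > 0\<close> by (simp add: C_def)
      then show ?thesis by (simp add: k_def right_diff_distrib flip: mult.assoc) (simp add: algebra_simps)
    qed
    finally show "2 * c * x * (- p * x + b * y + g) + 2 * b * y * (n - r * y + h)
        \<le> k * (C * \<rho>\<^sup>2 - (c * x\<^sup>2 + b * y\<^sup>2))" .
  qed
qed

section \<open>Lipschitz and convexity bounds for powers\<close>

lemma power_diff_bound:
  fixes x y w :: real
  assumes "0 \<le> x" "x \<le> w" "0 \<le> y" "y \<le> w"
  shows "\<bar>x ^ d - y ^ d\<bar> \<le> real d * w ^ (d - 1) * \<bar>x - y\<bar>"
proof -
  have w: "0 \<le> w" using assms by simp
  have "\<bar>x ^ d - y ^ d\<bar> = \<bar>x - y\<bar> * \<bar>\<Sum>i<d. y ^ (d - Suc i) * x ^ i\<bar>"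
    by (simp add: power_diff_sumr2 abs_mult)
  also have "\<bar>\<Sum>i<d. y ^ (d - Suc i) * x ^ i\<bar> \<le> (\<Sum>i<d. w ^ (d - 1))"
  proof (rule order_trans[OF sum_abs], rule sum_mono)
    fix i assume "i \<in> {..<d}"
    have "y ^ (d - Suc i) * x ^ i \<le> w ^ (d - Suc i) * w ^ i"
      using assms w by (intro mult_mono power_mono) auto
    also have "\<dots> = w ^ (d - 1)" using \<open>i \<in> {..<d}\<close> by (simp flip: power_add)
    finally show "\<bar>y ^ (d - Suc i) * x ^ i\<bar> \<le> w ^ (d - 1)" using assms by simp
  qed
  finally have "\<bar>x ^ d - y ^ d\<bar> \<le> \<bar>x - y\<bar> * (\<Sum>i<d. w ^ (d - 1))"
    by (simp add: mult_left_mono)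
  then show ?thesis by (simp add: ac_simps)
qed

text \<open>Convexity by induction: multiplying the tangent inequality for exponent \<open>d\<close>
  by \<open>x\<close> gives the one for \<open>Suc d\<close>, up to a nonnegative multiple of
  \<open>(x - y)\<^sup>2\<close>.\<close>

lemma power_ge_tangent:
  fixes x y :: real
  assumes "0 \<le> x" "0 \<le> y"
  shows "y ^ d + real d * y ^ (d - 1) * (x - y) \<le> x ^ d"
proof (induction d)
  case (Suc d)
  show ?case
  proof (cases d)
    case (Suc e)
    have "y ^ Suc d + real (Suc d) * y ^ d * (x - y)
        = x * (y ^ d + real d * y ^ e * (x - y)) - real d * y ^ e * (x - y)\<^sup>2"
      by (simp add: Suc algebra_simps power2_eq_square)
    also have "\<dots> \<le> x * (y ^ d + real d * y ^ e * (x - y))" using assms by simp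
    also have "\<dots> \<le> x * x ^ d"
      using mult_left_mono[OF Suc.IH \<open>0 \<le> x\<close>] by (simp add: Suc)
    finally show ?thesis by simp
  qed simp
qed simp

section \<open>The fixed-point polynomial\<close>

text \<open>\<open>LEAST\<close> is informative only if some \<open>d\<close> qualifies. For large
  \<open>d\<close> the power tends to 1 while the left-hand side tends to
  \<open>\<mu>\<^sub>1 / lam > 1\<close>; the midpoint of these limits separates them.\<close>

lemma d1_star_spec:
  fixes lam \<mu>\<^sub>1 \<mu>\<^sub>2 :: real
  assumes "\<mu>\<^sub>1 > lam" "lam > \<mu>\<^sub>2" "\<mu>\<^sub>2 > 0"
  defines "d \<equiv> d1_star lam \<mu>\<^sub>1 \<mu>\<^sub>2"
  shows "d \<ge> 2" "real d * lam * (1 / \<mu>\<^sub>2 - 1 / \<mu>\<^sub>1) > 1"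
    "(1 - 1 / real d) * (\<mu>\<^sub>1 / lam)
       > (real d * lam * (1 / \<mu>\<^sub>2 - 1 / \<mu>\<^sub>1)) powr (1 / (real d - 1))"
proof -
  define a where "a = lam * (1 / \<mu>\<^sub>2 - 1 / \<mu>\<^sub>1)"
  define c where "c = \<mu>\<^sub>1 / lam"
  have "a > 0" using assms unfolding a_def by (intro mult_pos_pos) (auto simp: field_simps)
  have "c > 1" using assms by (auto simp: c_def)
  define P where "P = (\<lambda>d::nat. d \<ge> 2 \<and> real d * lam * (1 / \<mu>\<^sub>2 - 1 / \<mu>\<^sub>1) > 1 \<and>
     (1 - 1 / real d) * (\<mu>\<^sub>1 / lam) > (real d * lam * (1 / \<mu>\<^sub>2 - 1 / \<mu>\<^sub>1)) powr (1 / (real d - 1)))"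
  have "\<forall>\<^sub>F d in sequentially. 1 < real d * a" using \<open>a > 0\<close> by real_asymp
  moreover have "\<forall>\<^sub>F d in sequentially. (real d * a) powr (1 / (real d - 1)) < (1 + c) / 2"
  proof (rule order_tendstoD(2))
    show "(\<lambda>d. (real d * a) powr (1 / (real d - 1))) \<longlonglongrightarrow> 1" using \<open>a > 0\<close> by real_asymp
  qed (use \<open>c > 1\<close> in auto)
  moreover have "\<forall>\<^sub>F d in sequentially. (1 - 1 / real d) * c > (1 + c) / 2"
  proof (rule order_tendstoD(1))
    show "(\<lambda>d. (1 - 1 / real d) * c) \<longlonglongrightarrow> c" by real_asymp
  qed (use \<open>c > 1\<close> in auto)
  ultimately have "\<forall>\<^sub>F d in sequentially. P d"
    using eventually_ge_at_top[of 2]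
      proof eventually_elim
    case (elim d)
    then have "1 < real d * a \<and> (real d * a) powr (1 / (real d - 1)) < (1 - 1 / real d) * c \<and> 2 \<le> d"
      by linarith
    then show ?case unfolding P_def a_def c_def by (simp add: mult.assoc)
  qed
  then have "P (LEAST d. P d)" by (metis LeastI eventually_happens sequentially_bot)
  then show "d \<ge> 2" "real d * lam * (1 / \<mu>\<^sub>2 - 1 / \<mu>\<^sub>1) > 1"
    "(1 - 1 / real d) * (\<mu>\<^sub>1 / lam)
       > (real d * lam * (1 / \<mu>\<^sub>2 - 1 / \<mu>\<^sub>1)) powr (1 / (real d - 1))"
    unfolding d_def d1_star_def P_def by auto
qed

definition fixpoint_eqn :: "real \<Rightarrow> real \<Rightarrow> real \<Rightarrow> nat \<Rightarrow> real \<Rightarrow> real" where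
  "fixpoint_eqn lam \<mu>\<^sub>1 \<mu>\<^sub>2 d u = lam * (1 / \<mu>\<^sub>2 - 1 / \<mu>\<^sub>1) * u ^ d - u + lam / \<mu>\<^sub>1"

text \<open>
  The witness is the minimizer of the polynomial for \<open>d = d1_star\<close>; on the unit interval
  the polynomial decreases with \<open>d\<close>.
\<close>
lemma fixpoint_eqn_negative:
  fixes lam \<mu>\<^sub>1 \<mu>\<^sub>2 :: real
  assumes "\<mu>\<^sub>1 > lam" "lam > \<mu>\<^sub>2" "\<mu>\<^sub>2 > 0" "d \<ge> d1_star lam \<mu>\<^sub>1 \<mu>\<^sub>2"
  obtains x where "0 < x" "x < 1" "fixpoint_eqn lam \<mu>\<^sub>1 \<mu>\<^sub>2 d x < 0"
proof -
  define a where "a = lam * (1 / \<mu>\<^sub>2 - 1 / \<mu>\<^sub>1)"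
  have "a > 0" using assms unfolding a_def by (intro mult_pos_pos) (auto simp: field_simps)
  define e where "e = d1_star lam \<mu>\<^sub>1 \<mu>\<^sub>2"
  note spec = d1_star_spec[OF assms(1-3), folded e_def]
  define D where "D = real e * a"
  have D: "D > 1" "D powr (1 / (real e - 1)) < (1 - 1 / real e) * (\<mu>\<^sub>1 / lam)"
    using spec by (simp_all add: D_def a_def mult.assoc)
  \<comment> \<open>Zero of the derivative for exponent \<open>e\<close>. There
    \<open>a * x ^ e = x / e\<close>, so the polynomial equals
    \<open>lam / \<mu>\<^sub>1 - (1 - 1 / e) * x\<close>, which the second condition on
    \<open>e\<close> makes negative; the first condition, \<open>D > 1\<close>, puts
    \<open>x\<close> below 1.\<close>
  define x where "x = D powr (- 1 / (real e - 1))"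
  have x: "0 < x" "x < 1" using D spec(1) by (auto simp: x_def powr_less_one)
  have "x ^ (e - 1) = D powr (- 1 / (real e - 1) * real (e - 1))"
    using D by (simp add: x_def powr_powr flip: powr_realpow)
  also have "- 1 / (real e - 1) * real (e - 1) = - 1" using spec(1) by (simp add: of_nat_diff)
  finally have "x ^ (e - 1) = 1 / D" using D by (simp add: powr_minus_divide)
  moreover have "x ^ e = x ^ (e - 1) * x" using spec(1) by (simp flip: power_Suc2)
  ultimately have "a * x ^ e = x / real e" using \<open>a > 0\<close> spec(1) by (simp add: D_def)
  moreover have "a * x ^ d \<le> a * x ^ e"
    using x \<open>a > 0\<close> assms(4) by (intro mult_left_mono power_decreasing) (auto simp: e_def)
  moreover have "lam / \<mu>\<^sub>1 < (1 - 1 / real e) * x"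
  proof -
    have "1 / x = D powr (1 / (real e - 1))" by (simp add: x_def powr_minus_divide)
    then have "1 / x < (1 - 1 / real e) * (\<mu>\<^sub>1 / lam)" using D by simp
    then have "1 / x * (x * (lam / \<mu>\<^sub>1)) < (1 - 1 / real e) * (\<mu>\<^sub>1 / lam) * (x * (lam / \<mu>\<^sub>1))"
      using x assms by (intro mult_strict_right_mono) auto
    then show ?thesis using x assms by simp
  qed
  ultimately have "fixpoint_eqn lam \<mu>\<^sub>1 \<mu>\<^sub>2 d x < 0"
    by (simp add: fixpoint_eqn_def a_def algebra_simps)
  with x that show ?thesis by blast
qed

lemma fixpoint_eqn_deriv:
  "(fixpoint_eqn lam \<mu>\<^sub>1 \<mu>\<^sub>2 d has_real_derivative
     lam * (1 / \<mu>\<^sub>2 - 1 / \<mu>\<^sub>1) * (real d * u ^ (d - 1)) - 1) (at u)"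
  unfolding fixpoint_eqn_def[abs_def] by (auto intro!: derivative_eq_intros)

lemma fixpoint_eqn_roots:
  fixes lam \<mu>\<^sub>1 \<mu>\<^sub>2 :: real
  assumes "\<mu>\<^sub>1 > lam" "lam > \<mu>\<^sub>2" "\<mu>\<^sub>2 > 0" "d \<ge> d1_star lam \<mu>\<^sub>1 \<mu>\<^sub>2"
  obtains u v where "0 < u" "u < v" "v < 1"
    "\<And>y. 0 \<le> y \<Longrightarrow> y < 1 \<Longrightarrow> fixpoint_eqn lam \<mu>\<^sub>1 \<mu>\<^sub>2 d y = 0 \<longleftrightarrow> y = u \<or> y = v"
    "lam * (1 / \<mu>\<^sub>2 - 1 / \<mu>\<^sub>1) * (real d * u ^ (d - 1)) < 1"
    "lam * (1 / \<mu>\<^sub>2 - 1 / \<mu>\<^sub>1) * (real d * v ^ (d - 1)) > 1"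
proof -
  define f where "f = fixpoint_eqn lam \<mu>\<^sub>1 \<mu>\<^sub>2 d"
  define f' where "f' = (\<lambda>u. lam * (1 / \<mu>\<^sub>2 - 1 / \<mu>\<^sub>1) * (real d * u ^ (d - 1)) - 1)"
  have "d \<ge> 2" using d1_star_spec(1)[OF assms(1-3)] assms(4) by simp
  have pos: "lam * (1 / \<mu>\<^sub>2 - 1 / \<mu>\<^sub>1) > 0"
    using assms by (intro mult_pos_pos) (auto simp: field_simps)
  have deriv: "(f has_real_derivative f' u) (at u)" for u
    unfolding f_def f'_def by (rule fixpoint_eqn_deriv)
  have cont: "continuous_on A f" for A
    using deriv by (intro continuous_at_imp_continuous_on) (auto intro: DERIV_isCont)
  have mono: "f' x < f' y" if "0 \<le> x" "x < y" for x y
    unfolding f'_def using pos that \<open>d \<ge> 2\<close> by (auto intro!: mult_strict_left_mono power_strict_mono)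
  obtain x where x: "0 < x" "x < 1" "f x < 0"
    using fixpoint_eqn_negative[OF assms] unfolding f_def by blast
  have f0: "f 0 > 0" using assms \<open>d \<ge> 2\<close> by (simp add: f_def fixpoint_eqn_def power_0_left)
  have f1: "f 1 > 0" using assms by (simp add: f_def fixpoint_eqn_def right_diff_distrib)
  obtain u where u: "0 \<le> u" "u \<le> x" "f u = 0"
    using IVT2'[of f x 0 0] f0 x cont by auto
  obtain v where v: "x \<le> v" "v \<le> 1" "f v = 0"
    using IVT'[of f x 0 1] f1 x cont by auto
  have uv: "0 < u" "u < x" "x < v" "v < 1"
    using u v x f0 f1 by (metis order_le_less order_less_irrefl)+
  have mvt: "\<exists>z. a < z \<and> z < b \<and> f b - f a = (b - a) * f' z" if "a < b" for a b
    using MVT2[OF that] deriv by blast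
  \<comment> \<open>The polynomial falls from \<open>u\<close> to \<open>x\<close>, so its
    derivative is negative at some \<open>z > u\<close>; as the derivative increases, it is negative
    at \<open>u\<close> too. The argument at \<open>v\<close> is symmetric.\<close>
  obtain z where z: "u < z" "z < x" "f x - f u = (x - u) * f' z" using mvt[OF uv(2)] by blast
  then have "f' z < 0" using x u uv by (smt (verit) mult_nonneg_nonneg)
  then have fu: "f' u < 0" using mono[of u z] z u by simp
  obtain y where y: "x < y" "y < v" "f v - f x = (v - x) * f' y" using mvt[OF uv(3)] by blast
  then have "f' y > 0" using x v uv by (smt (verit) mult_nonneg_nonpos)
  then have fv: "f' v > 0" using mono[of y v] y x by simp
  \<comment> \<open>Three roots would give, by Rolle, two zeros of the strictly increasing
    derivative.\<close>
  have no3: False if abc: "0 \<le> a" "a < b" "b < c" "f a = 0" "f b = 0" "f c = 0" for a b c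
  proof -
    obtain z where "a < z" "z < b" "f' z = 0" using mvt[OF abc(2)] abc by auto
    moreover obtain y where "b < y" "y < c" "f' y = 0" using mvt[OF abc(3)] abc by auto
    ultimately show False using mono[of z y] abc by simp
  qed
  have "f y = 0 \<longleftrightarrow> y = u \<or> y = v" if "0 \<le> y" for y
    using u v uv no3[of y u v] no3[of u y v] no3[of u v y] that
    by (metis less_trans linorder_neqE_linordered_idom order_less_imp_le)
  then show ?thesis using that[of u v] uv fu fv by (auto simp: f_def f'_def)
qed

section \<open>Existence of solutions\<close>

lemma indefinite_integral_deriv_atLeast:
  fixes f :: "real \<Rightarrow> 'a::banach"
  assumes "continuous_on {0..} f" "0 \<le> t"
  shows "((\<lambda>x. integral {0..x} f) has_vector_derivative f t) (at t within {0..})"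
proof -
  have "((\<lambda>x. integral {0..x} f) has_vector_derivative f t) (at t within {0..t+1})"
    using assms by (intro integral_has_vector_derivative) (auto intro: continuous_on_subset)
  moreover have "at t within {0..t+1} = at t within {0..}"
    by (rule at_within_nhd[of t "{..<t+1}"]) auto
  ultimately show ?thesis by simp
qed

lemma integral_exp_bound:
  fixes K t :: real
  assumes "K > 0" "0 \<le> t"
  shows "integral {0..t} (\<lambda>s. exp (K * s)) \<le> exp (K * t) / K"
proof -
  have "((\<lambda>s. exp (K * s)) has_integral (exp (K * t) / K - exp (K * 0) / K)) {0..t}"
    using assms
    by (intro fundamental_theorem_of_calculus)
       (auto intro!: derivative_eq_intros simp flip: has_real_derivative_iff_has_vector_derivative)
  then show ?thesis using assms by (simp add: integral_unique)
qed

text \<open>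
  Picard's operator is a contraction on the whole half line in the norm
  \<open>SUP t. exp (- 2 * L * t) * norm (y t)\<close>, so no continuation argument is needed.
\<close>
lemma lipschitz_ode_exists:
  fixes G :: "'a::banach \<Rightarrow> 'a" and h :: "real \<Rightarrow> 'a"
  assumes "L > 0" and lip: "\<And>x y. norm (G x - G y) \<le> L * norm (x - y)"
    and h: "continuous_on {0..} h" "\<And>t. 0 \<le> t \<Longrightarrow> norm (h t) \<le> H"
  obtains y where "y 0 = y0"
    "\<And>t. 0 \<le> t \<Longrightarrow> (y has_vector_derivative G (y t) + h t) (at t within {0..})"
proof -
  \<comment> \<open>Under the weight \<open>exp (- K * t)\<close> the integral operator has
    Lipschitz constant \<open>L / K\<close>, here one half.\<close>
  define K where "K = 2 * L"
  have K: "K > 0" using \<open>L > 0\<close> by (simp add: K_def)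
  have contG: "continuous_on A G" for A
  proof (rule continuous_on_subset[of UNIV])
    show "continuous_on UNIV G"
    proof (rule lipschitz_on_continuous_on)
      show "L-lipschitz_on UNIV G"
        using lip \<open>L > 0\<close> by (intro lipschitz_onI) (auto simp: dist_norm)
    qed
  qed simp
  \<comment> \<open>The unknown is the weighted path
    \<open>z t = exp (- K * t) *\<^sub>R y t\<close>, a point of the complete space of bounded
    continuous functions. That space lives on the whole real line, so \<open>max 0 t\<close> in
    \<open>U\<close> extends paths constantly to negative times.\<close>
  define F where "F = (\<lambda>(z::real \<Rightarrow>\<^sub>C 'a) s. G (exp (K * s) *\<^sub>R apply_bcontfun z s) + h s)"
  define U where "U = (\<lambda>z t. exp (- K * max 0 t) *\<^sub>R (y0 + integral {0..max 0 t} (F z)))"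
  have contF: "continuous_on {0..} (F z)" for z
    unfolding F_def
    by (intro continuous_intros h continuous_on_compose2[OF contG[of UNIV]]) auto
  have int: "F z integrable_on {0..t}" for z t
    by (rule integrable_continuous_real, rule continuous_on_subset[OF contF]) auto
  have inte: "(\<lambda>s. c * exp (K * s)) integrable_on {0..t}" for t c
    by (intro integrable_continuous_real continuous_intros)
  have contI: "continuous_on {0..} (\<lambda>t. integral {0..t} (F z))" for z
    using indefinite_integral_deriv_atLeast[OF contF]
    by (auto simp: continuous_on_eq_continuous_within intro!: has_vector_derivative_continuous)
  have contU: "continuous_on UNIV (U z)" for z
    unfolding U_def
    by (intro continuous_intros continuous_on_compose2[OF contI[of z]]) auto
  have normint: "exp (- K * t) * norm (integral {0..t} f) \<le> c / K"
    if "0 \<le> t" "f integrable_on {0..t}" "\<And>s. 0 \<le> s \<Longrightarrow> s \<le> t \<Longrightarrow> norm (f s) \<le> c * exp (K * s)" "c \<ge> 0"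
    for t c and f :: "real \<Rightarrow> 'a"
  proof -
    have "norm (integral {0..t} f) \<le> integral {0..t} (\<lambda>s. c * exp (K * s))"
      using that inte by (intro integral_norm_bound_integral) auto
    also have "\<dots> \<le> c * (exp (K * t) / K)"
      using integral_exp_bound[OF K \<open>0 \<le> t\<close>] \<open>c \<ge> 0\<close> by (simp only: integral_mult_right mult_left_mono)
    finally have "exp (- K * t) * norm (integral {0..t} f) \<le> exp (- K * t) * (c * (exp (K * t) / K))"
      by (intro mult_left_mono) auto
    also have "\<dots> = c / K" by (simp add: exp_minus field_simps)
    finally show ?thesis .
  qed
  have normF: "norm (F z s) \<le> (norm (G 0) + L * norm z + H) * exp (K * s)" if "0 \<le> s" for z s
  proof -
    have e: "1 \<le> exp (K * s)" using K that by simp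
    have "0 \<le> H" using h(2)[of 0] norm_ge_zero[of "h 0"] by linarith
    have "norm (G (exp (K * s) *\<^sub>R apply_bcontfun z s) - G 0) \<le> L * (exp (K * s) * norm (apply_bcontfun z s))"
      using lip[of "exp (K * s) *\<^sub>R apply_bcontfun z s" 0] by simp
    also have "\<dots> \<le> L * (exp (K * s) * norm z)"
      using \<open>L > 0\<close> norm_bounded[of z s] by (intro mult_left_mono) auto
    finally have "norm (F z s) \<le> norm (G 0) + L * (exp (K * s) * norm z) + H"
      unfolding F_def using h(2)[OF that]
      by (smt (verit) norm_triangle_ineq norm_triangle_sub)
    also have "\<dots> \<le> norm (G 0) * exp (K * s) + L * (exp (K * s) * norm z) + H * exp (K * s)"
      using e \<open>0 \<le> H\<close> mult_left_mono[OF e, of "norm (G 0)"] mult_left_mono[OF e, of H] by simp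
    finally show ?thesis by (simp add: algebra_simps)
  qed
  have U: "U z \<in> bcontfun" for z
  proof (rule bcontfun_normI[OF contU])
    fix t
    define C where "C = norm (G 0) + L * norm z + H"
    have "0 \<le> H" using h(2)[of 0] norm_ge_zero[of "h 0"] by linarith
    then have "C \<ge> 0" using \<open>L > 0\<close> by (simp add: C_def)
    have "norm (U z t) \<le> exp (- K * max 0 t) * (norm y0 + norm (integral {0..max 0 t} (F z)))"
      unfolding U_def by (auto intro!: mult_left_mono norm_triangle_ineq)
    also have "\<dots> \<le> 1 * norm y0 + C / K"
      unfolding distrib_left using K normF[of _ z] \<open>C \<ge> 0\<close>
      by (intro add_mono mult_right_mono normint int) (auto simp: C_def)
    finally show "norm (U z t) \<le> 1 * norm y0 + (norm (G 0) + L * norm z + H) / K"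
      by (simp add: C_def)
  qed
  define \<Phi> where "\<Phi> = (\<lambda>z. Bcontfun (U z))"
  have app: "apply_bcontfun (\<Phi> z) = U z" for z
    unfolding \<Phi>_def by (rule Bcontfun_inverse[OF U])
  have "dist (\<Phi> z) (\<Phi> w) \<le> (1/2) * dist z w" for z w
  proof -
    have "norm (apply_bcontfun (\<Phi> z - \<Phi> w) t) \<le> L * dist z w / K" for t
    proof -
      define s where "s = max 0 t"
      have "apply_bcontfun (\<Phi> z - \<Phi> w) t = exp (- K * s) *\<^sub>R integral {0..s} (\<lambda>r. F z r - F w r)"
        by (simp add: app U_def s_def int Henstock_Kurzweil_Integration.integral_diff scaleR_diff_right[symmetric])
      also have "norm \<dots> = exp (- K * s) * norm (integral {0..s} (\<lambda>r. F z r - F w r))" by simp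
      also have "\<dots> \<le> L * dist z w / K"
      proof (rule normint)
        fix r :: real assume "0 \<le> r"
        have "norm (F z r - F w r) \<le> L * norm (exp (K * r) *\<^sub>R apply_bcontfun z r - exp (K * r) *\<^sub>R apply_bcontfun w r)"
          unfolding F_def using lip by simp
        also have "\<dots> = L * (exp (K * r) * dist (apply_bcontfun z r) (apply_bcontfun w r))"
          by (simp add: dist_norm flip: scaleR_diff_right)
        also have "\<dots> \<le> L * (exp (K * r) * dist z w)"
          using \<open>L > 0\<close> by (intro mult_left_mono dist_bounded) auto
        finally show "norm (F z r - F w r) \<le> L * dist z w * exp (K * r)" by (simp add: ac_simps)
      qed (use \<open>L > 0\<close> int in \<open>auto simp: s_def intro!: integrable_diff\<close>)
      finally show ?thesis .
    qed
    then have "norm (\<Phi> z - \<Phi> w) \<le> L * dist z w / K" by (rule norm_bound)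
    then show ?thesis using \<open>L > 0\<close> by (simp add: dist_norm K_def)
  qed
  then obtain z where z: "\<Phi> z = z" using banach_fix_type[of "1/2" \<Phi>] by auto
  define y where "y = (\<lambda>t. y0 + integral {0..t} (F z))"
  have y: "exp (K * t) *\<^sub>R apply_bcontfun z t = y t" if "0 \<le> t" for t
  proof -
    have "apply_bcontfun z t = U z t" using app[of z] z by simp
    then have "exp (K * t) *\<^sub>R apply_bcontfun z t = (exp (K * t) * exp (- K * t)) *\<^sub>R y t"
      using that by (simp add: U_def y_def max_def)
    then show ?thesis by (simp flip: exp_add)
  qed
  show ?thesis
  proof (rule that)
    show "y 0 = y0" by (simp add: y_def)
    fix t :: real assume t: "0 \<le> t"
    have "(y has_vector_derivative F z t) (at t within {0..})"
      unfolding y_def using indefinite_integral_deriv_atLeast[OF contF t, of z]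
      by (auto intro!: derivative_eq_intros)
    then show "(y has_vector_derivative G (y t) + h t) (at t within {0..})"
      using y[OF t] by (simp add: F_def)
  qed
qed

text \<open>
  A solution of the infinite triangular system \<open>A\<^sub>i' = - \<mu> * (A\<^sub>i - A\<^sub>i\<^sub>+\<^sub>1)\<close>, namely
  the expectation of \<open>a (i + N)\<close> for a Poisson variable \<open>N\<close> of mean \<open>\<mu> * t\<close>.
\<close>
definition death :: "real \<Rightarrow> (nat \<Rightarrow> real) \<Rightarrow> nat \<Rightarrow> real \<Rightarrow> real" where
  "death \<mu> a i t = exp (- \<mu> * t) * (\<Sum>k. a (i + k) / fact k * (\<mu> * t) ^ k)"

context
  fixes \<mu> M :: real and a :: "nat \<Rightarrow> real"
  assumes bnd: "\<And>i. \<bar>a i\<bar> \<le> M"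
begin

lemma death_summable: "summable (\<lambda>k. a (i + k) / fact k * x ^ k)"
proof (rule summable_comparison_test')
  show "summable (\<lambda>k. M * (inverse (fact k) * \<bar>x\<bar> ^ k))"
    by (intro summable_mult summable_exp)
  show "norm (a (i + k) / fact k * x ^ k) \<le> M * (inverse (fact k) * \<bar>x\<bar> ^ k)" for k
    using bnd[of "i + k"] by (simp add: abs_mult power_abs divide_simps mult_right_mono)
qed

text \<open>Termwise differentiation of a series with weights \<open>1 / fact k\<close> shifts the
  coefficients by one, which is the passage from \<open>i\<close> to \<open>Suc i\<close>; the
  prefactor supplies the loss term.\<close>

lemma death_deriv:
  "(death \<mu> a i has_real_derivative - \<mu> * (death \<mu> a i t - death \<mu> a (Suc i) t)) (at t)"
proof -
  have "diffs (\<lambda>k. a (i + k) / fact k) k = a (Suc i + k) / fact k" for k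
    by (simp add: diffs_def divide_simps fact_num_eq_if)
  then have "((\<lambda>x. \<Sum>k. a (i + k) / fact k * x ^ k) has_field_derivative
      (\<Sum>k. a (Suc i + k) / fact k * x ^ k)) (at x)" for x
    using termdiffs_strong_converges_everywhere[OF death_summable, of i x] by simp
  then have "((\<lambda>t. \<Sum>k. a (i + k) / fact k * (\<mu> * t) ^ k) has_field_derivative
      (\<Sum>k. a (Suc i + k) / fact k * (\<mu> * t) ^ k) * \<mu>) (at t)"
    by (rule DERIV_chain2) (auto intro!: derivative_eq_intros)
  then show ?thesis
    unfolding death_def by (auto intro!: derivative_eq_intros simp: algebra_simps)
qed

lemma death_mono:
  assumes "\<And>k. a (i + k) \<le> a (j + k)" "0 \<le> \<mu> * t"
  shows "death \<mu> a i t \<le> death \<mu> a j t"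
  unfolding death_def using assms
  by (intro mult_left_mono suminf_le death_summable mult_right_mono divide_right_mono) auto

lemma death_bounds:
  assumes "\<And>k. 0 \<le> a (i + k)" "\<And>k. a (i + k) \<le> c" "0 \<le> \<mu> * t"
  shows "0 \<le> death \<mu> a i t" "death \<mu> a i t \<le> c"
proof -
  show "0 \<le> death \<mu> a i t"
    unfolding death_def using assms by (intro mult_nonneg_nonneg suminf_nonneg death_summable) auto
  have "(\<Sum>k. a (i + k) / fact k * (\<mu> * t) ^ k) \<le> (\<Sum>k. c * (inverse (fact k) * (\<mu> * t) ^ k))"
  proof (intro suminf_le death_summable summable_mult summable_exp)
    fix k
    have "a (i + k) * ((\<mu> * t) ^ k / fact k) \<le> c * ((\<mu> * t) ^ k / fact k)"
      using assms by (intro mult_right_mono) auto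
    then show "a (i + k) / fact k * (\<mu> * t) ^ k \<le> c * (inverse (fact k) * (\<mu> * t) ^ k)"
      by (simp add: divide_inverse ac_simps)
  qed
  also have "\<dots> = c * exp (\<mu> * t)"
    by (subst suminf_mult[OF summable_exp]) (simp add: exp_def divide_inverse ac_simps)
  finally have "death \<mu> a i t \<le> exp (- \<mu> * t) * (c * exp (\<mu> * t))"
    unfolding death_def by (intro mult_left_mono) auto
  then show "death \<mu> a i t \<le> c" by (simp add: exp_minus field_simps)
qed

end

lemma death_0: "death \<mu> a i 0 = a i"
proof -
  have "(\<Sum>k. a (i + k) / fact k * 0 ^ k) = a i" using powser_zero[of "\<lambda>k. a (i + k) / fact k"] by simp
  then show ?thesis by (simp add: death_def)
qed

section \<open>States and their tails\<close>

lemma exhaust_two: "(j::2) = 0 \<or> j = 1"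
proof -
  have "{0, 1} = (UNIV :: 2 set)" by (rule card_subset_eq) auto
  then show ?thesis by auto
qed

lemma has_sum_insert_first:
  fixes f :: "nat \<Rightarrow> real"
  assumes "(f has_sum s) {Suc n..}"
  shows "(f has_sum (f n + s)) {n..}"
proof -
  have "{n..} = insert n {Suc n..}" by auto
  then show ?thesis using has_sum_insert[OF _ assms, of n] by simp
qed

lemma has_sum_family:
  fixes f :: family
  assumes "((\<lambda>i. f i 0) has_sum a) UNIV" "((\<lambda>i. f i 1) has_sum b) UNIV"
  shows "((\<lambda>(i, j). f i j) has_sum (a + b)) UNIV"
proof -
  have *: "((\<lambda>(i, j). f i j) has_sum s) (range (\<lambda>i. (i, j))) \<longleftrightarrow> ((\<lambda>i. f i j) has_sum s) UNIV" for s j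
    by (subst has_sum_reindex) (auto simp: inj_on_def o_def)
  have "((\<lambda>(i, j). f i j) has_sum (a + b)) (range (\<lambda>i. (i, 0)) \<union> range (\<lambda>i. (i, 1)))"
    using assms by (intro has_sum_Un_disjoint) (auto simp: *)
  moreover have "range (\<lambda>i. (i, 0)) \<union> range (\<lambda>i. (i, 1)) = (UNIV :: (nat \<times> 2) set)"
    using exhaust_two by fast
  ultimately show ?thesis by simp
qed

context
  fixes q :: family
  assumes state: "is_state q"
begin

lemma state_nonneg: "0 \<le> q i j"
  using state by (simp add: is_state_def)

lemma state_summable: "(\<lambda>i. q i j) summable_on A"
proof -
  have "(\<lambda>(i, j). q i j) summable_on UNIV" using state by (auto simp: is_state_def summable_on_def)
  then have "(\<lambda>(i, j). q i j) summable_on range (\<lambda>i. (i, j))" by (rule summable_on_subset_banach) auto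
  then have "(\<lambda>i. q i j) summable_on UNIV"
    by (subst (asm) summable_on_reindex) (auto simp: inj_on_def o_def)
  then show ?thesis by (rule summable_on_subset_banach) auto
qed

lemma state_has_sum_tail: "((\<lambda>k. q k j) has_sum tail q i j) {i..}"
  unfolding tail_def by (rule has_sum_infsum[OF state_summable])

lemma state_tail_step: "tail q i j = q i j + tail q (Suc i) j"
  using has_sum_unique[OF state_has_sum_tail has_sum_insert_first[OF state_has_sum_tail]] .

lemma state_tail_nonneg: "0 \<le> tail q i j"
  unfolding tail_def by (intro infsum_nonneg state_nonneg)

lemma state_tail_antimono: "i \<le> k \<Longrightarrow> tail q k j \<le> tail q i j"
proof (rule lift_Suc_antimono_le[of "\<lambda>i. tail q i j"])
  show "tail q (Suc n) j \<le> tail q n j" for n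
    using state_tail_step[of n j] state_nonneg[of n j] by simp
qed

lemma state_tail_tendsto_0: "(\<lambda>i. tail q i j) \<longlonglongrightarrow> 0"
proof -
  have "(\<lambda>n. \<Sum>k<n. q k j) \<longlonglongrightarrow> tail q 0 j"
    using has_sum_imp_sums[OF state_has_sum_tail[of j 0, simplified]] by (simp add: sums_def)
  then have "(\<lambda>n. tail q 0 j - (\<Sum>k<n. q k j)) \<longlonglongrightarrow> tail q 0 j - tail q 0 j"
    by (intro tendsto_intros)
  moreover have "tail q 0 j - (\<Sum>k<n. q k j) = tail q n j" for n
  proof (induction n)
    case (Suc n)
    then show ?case using state_tail_step[of n j] by simp
  qed simp
  ultimately show ?thesis by simp
qed

lemma state_tail_sum: "tail q 0 0 + tail q 0 1 = 1"
proof -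
  have "((\<lambda>(i, j). q i j) has_sum (tail q 0 0 + tail q 0 1)) UNIV"
    using state_has_sum_tail[of _ 0] by (intro has_sum_family) auto
  then show ?thesis using state by (auto simp: is_state_def dest: has_sum_unique)
qed

lemma state_tail_le_1: "tail q i j \<le> 1"
  using state_tail_antimono[of 0 i j] state_tail_sum state_tail_nonneg[of 0 0] state_tail_nonneg[of 0 1]
    exhaust_two[of j] by auto

text \<open>Off its three sites \<open>p\<close> vanishes, so the absolute differences there are the
  entries of \<open>q\<close> and add up to two tails.\<close>

lemma l1_dist_three_point:
  assumes p: "is_state p" "\<And>i. 2 \<le> i \<Longrightarrow> p i 0 = 0" "\<And>i. 1 \<le> i \<Longrightarrow> p i 1 = 0"
  shows "l1_dist q p = \<bar>q 0 0 - p 0 0\<bar> + \<bar>q 0 1 - p 0 1\<bar> + \<bar>q 1 0 - p 1 0\<bar> + tail q 2 0 + tail q 1 1"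
proof -
  let ?f = "\<lambda>i j. \<bar>q i j - p i j\<bar>"
  have "((\<lambda>i. ?f i 0) has_sum tail q 2 0) {Suc (Suc 0)..}"
    using has_sum_cong[THEN iffD2, OF _ state_has_sum_tail[of 0 2]] p(2) state_nonneg
    by (simp add: numeral_2_eq_2)
  then have 0: "((\<lambda>i. ?f i 0) has_sum (?f 0 0 + (?f (Suc 0) 0 + tail q 2 0))) {0..}"
    by (intro has_sum_insert_first)
  have "((\<lambda>i. ?f i 1) has_sum tail q 1 1) {Suc 0..}"
    using has_sum_cong[THEN iffD2, OF _ state_has_sum_tail[of 1 1]] p(3) state_nonneg by simp
  then have 1: "((\<lambda>i. ?f i 1) has_sum (?f 0 1 + tail q 1 1)) {0..}"
    by (intro has_sum_insert_first)
  show ?thesis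
    unfolding l1_dist_def
    by (subst infsumI[OF has_sum_family[OF 0[simplified] 1[simplified]]]) simp
qed

end

text \<open>The equations govern tails, so solutions are constructed as tails; telescoping recovers
  the state.\<close>

lemma state_of_tails:
  fixes Q :: family
  assumes mono: "\<And>i j. Q (Suc i) j \<le> Q i j" and lim: "\<And>j. (\<lambda>i. Q i j) \<longlonglongrightarrow> 0"
    and one: "Q 0 0 + Q 0 1 = 1"
  defines "q \<equiv> (\<lambda>i j. Q i j - Q (Suc i) j)"
  shows "is_state q" "tail q = Q"
proof -
  have sum: "((\<lambda>k. q k j) has_sum Q i j) {i..}" for i j
  proof -
    have "(\<lambda>n. q (n + i) j) sums (Q (0 + i) j - 0)"
      unfolding q_def using telescope_sums'[OF LIMSEQ_ignore_initial_segment[OF lim, of i j]] by simp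
    then have "((\<lambda>n. q (n + i) j) has_sum Q i j) UNIV"
      using mono by (intro sums_nonneg_imp_has_sum) (auto simp: q_def)
    then have "((\<lambda>k. q k j) has_sum Q i j) (range (\<lambda>n. n + i))"
      by (subst has_sum_reindex) (auto simp: o_def)
    moreover have "range (\<lambda>n. n + i) = {i..}"
      by (auto simp: image_iff) (metis le_add_diff_inverse2)
    ultimately show ?thesis by simp
  qed
  show "tail q = Q" by (intro ext) (simp add: tail_def infsumI[OF sum])
  have "((\<lambda>(i, j). q i j) has_sum (Q 0 0 + Q 0 1)) UNIV"
    using sum[of _ 0] by (intro has_sum_family) auto
  then show "is_state q" using mono one by (simp add: is_state_def q_def)
qed

text \<open>The shape of every fixed point in the idle region, and of the initial states in the
  instability proof. The parameters are its planar coordinates \<open>1 - q 0 0\<close> and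
  \<open>tail q 0 1\<close>.\<close>

definition three_point :: "real \<Rightarrow> real \<Rightarrow> family" where
  "three_point u v i j =
     (if i = 0 then if j = 0 then 1 - u else v else if i = 1 \<and> j = 0 then u - v else 0)"

lemma three_point_simps [simp]:
  "three_point u v 0 0 = 1 - u" "three_point u v 0 1 = v" "three_point u v 1 0 = u - v"
  "three_point u v (Suc 0) 0 = u - v"
  "1 \<le> i \<Longrightarrow> three_point u v i 1 = 0" "2 \<le> i \<Longrightarrow> three_point u v i 0 = 0"
  by (auto simp: three_point_def)

lemma three_point_state:
  assumes "0 \<le> v" "v \<le> u" "u \<le> 1"
  shows "is_state (three_point u v)"
proof -
  have "((\<lambda>i. three_point u v i 0) has_sum (1 - u + ((u - v) + 0))) {0..}"
    using has_sum_insert_first[OF has_sum_insert_first[OF has_sum_0], of 0 "\<lambda>i. three_point u v i 0"]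
    by simp
  moreover have "((\<lambda>i. three_point u v i 1) has_sum (v + 0)) {0..}"
    using has_sum_insert_first[OF has_sum_0, of 0 "\<lambda>i. three_point u v i 1"] by simp
  ultimately have "((\<lambda>(i, j). three_point u v i j) has_sum (1 - u + (u - v + 0) + (v + 0))) UNIV"
    by (intro has_sum_family) simp_all
  moreover have "0 \<le> three_point u v i j" for i j
    using assms by (auto simp: three_point_def)
  ultimately show ?thesis by (simp add: is_state_def)
qed

lemma three_point_tail: "tail (three_point u v) 1 1 = 0" "tail (three_point u v) 2 0 = 0"
  unfolding tail_def by (auto intro!: infsum_0)

text \<open>
  Coordinates of a state: \<open>u = 1 - q 0 0\<close> and \<open>V = tail q 0 1\<close> describe it up to the mass
  \<open>tail q 1 1 + tail q 2 0\<close>.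
\<close>
context
  fixes q :: family
  assumes state: "is_state q"
begin

lemma coordinates:
  "q 0 1 = tail q 0 1 - tail q 1 1" "q 1 0 = 1 - q 0 0 - tail q 0 1 - tail q 2 0"
  "tail q 1 0 = 1 - q 0 0 - tail q 0 1" "0 \<le> 1 - q 0 0"
  using state_tail_step[OF state, of 0 0] state_tail_step[OF state, of 0 1]
    state_tail_step[OF state, of 1 0] state_tail_sum[OF state] state_tail_le_1[OF state, of 0 0]
    state_tail_nonneg[OF state, of 1 0]
  by (simp_all add: numeral_2_eq_2)

text \<open>Makes the distance equivalent to the planar deviations plus the decaying mass, so that
  all estimates can be scalar. The factors 2 arise because \<open>q 0 1\<close> and
  \<open>q 1 0\<close> are not coordinates themselves but differ from \<open>V\<close> and
  \<open>u - V\<close> by a decaying tail each.\<close>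

lemma l1_dist_three_point_bounds:
  assumes "0 \<le> v" "v \<le> u" "u \<le> 1"
  defines "D \<equiv> l1_dist q (three_point u v)"
  shows "\<bar>(1 - q 0 0) - u\<bar> \<le> D" "\<bar>tail q 0 1 - v\<bar> \<le> D" "tail q 1 1 + tail q 2 0 \<le> D"
    "D \<le> 2 * \<bar>(1 - q 0 0) - u\<bar> + 2 * \<bar>tail q 0 1 - v\<bar> + 2 * (tail q 1 1 + tail q 2 0)"
proof -
  define x where "x = \<bar>(1 - q 0 0) - u\<bar>"
  define y where "y = \<bar>tail q 0 1 - v\<bar>"
  define y' where "y' = \<bar>q 0 1 - v\<bar>"
  define z where "z = \<bar>q 1 0 - (u - v)\<bar>"
  have "D = \<bar>q 0 0 - (1 - u)\<bar> + y' + z + tail q 2 0 + tail q 1 1"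
    unfolding D_def y'_def z_def
    by (subst l1_dist_three_point[OF state three_point_state]) (use assms in auto)
  also have "\<bar>q 0 0 - (1 - u)\<bar> = x" by (simp add: x_def)
  finally have D: "D = x + y' + z + tail q 2 0 + tail q 1 1" .
  have nonneg: "0 \<le> tail q 1 1" "0 \<le> tail q 2 0" by (intro state_tail_nonneg[OF state])+
  have tri: "y' \<le> y + tail q 1 1" "z \<le> x + y + tail q 2 0" "y \<le> y' + tail q 1 1"
    unfolding x_def y_def y'_def z_def using coordinates(1,2) nonneg by linarith+
  have "0 \<le> x" "0 \<le> y'" "0 \<le> z" by (simp_all add: x_def y'_def z_def)
  then show "\<bar>(1 - q 0 0) - u\<bar> \<le> D" "\<bar>tail q 0 1 - v\<bar> \<le> D" "tail q 1 1 + tail q 2 0 \<le> D"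
    "D \<le> 2 * \<bar>(1 - q 0 0) - u\<bar> + 2 * \<bar>tail q 0 1 - v\<bar> + 2 * (tail q 1 1 + tail q 2 0)"
    unfolding x_def[symmetric] y_def[symmetric] distrib_left using D nonneg tri by linarith+
qed

end

section \<open>Dynamics in the idle region\<close>

locale FL =
  fixes lam \<mu>\<^sub>1 \<mu>\<^sub>2 :: real and d :: nat
  assumes params: "lam < \<mu>\<^sub>1" "\<mu>\<^sub>2 < lam" "0 < \<mu>\<^sub>2" "2 \<le> d"
begin

abbreviation rhs where "rhs \<equiv> FL_rhs lam \<mu>\<^sub>1 \<mu>\<^sub>2 d"
abbreviation solution where "solution \<equiv> FL_solution lam \<mu>\<^sub>1 \<mu>\<^sub>2 d"
abbreviation root_eqn where "root_eqn \<equiv> fixpoint_eqn lam \<mu>\<^sub>1 \<mu>\<^sub>2 d"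

text \<open>The indices whose tails receive no arrivals in the idle region. The set is closed under
  \<open>Suc\<close> in the first index, which makes these equations autonomous.\<close>

definition decaying :: "nat \<Rightarrow> 2 \<Rightarrow> bool" where
  "decaying i j \<longleftrightarrow> 2 \<le> i \<or> i = 1 \<and> j = 1"

lemma decaying_simps [simp]: "decaying (Suc 0) 1" "decaying 1 1" "decaying 2 0"
  by (simp_all add: decaying_def)

lemma pos: "0 < lam" "0 < \<mu>\<^sub>1" "0 < \<mu>\<^sub>2" "0 < \<mu>\<^sub>1 - \<mu>\<^sub>2"
  using params by auto

lemma rhs_idle:
  assumes "is_state q" "q 0 0 > 0"
  shows "rhs q 0 0 = \<mu>\<^sub>2 * q 0 1 - lam * (1 - q 0 0) ^ d"
    "rhs q 0 1 = - \<mu>\<^sub>2 * q 0 1 + lam * (1 - q 0 0) ^ d"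
    "rhs q 1 0 = - \<mu>\<^sub>1 * q 1 0 + lam * (1 - (1 - q 0 0) ^ d)"
    "decaying i j \<Longrightarrow> rhs q i j = - \<mu>\<^sub>1 * (tail q i j - tail q (Suc i) j)"
    "decaying i j \<Longrightarrow> rhs q i j = - \<mu>\<^sub>1 * q i j"
proof -
  note step = state_tail_step[OF assms(1)]
  show "rhs q 0 0 = \<mu>\<^sub>2 * q 0 1 - lam * (1 - q 0 0) ^ d"
    "rhs q 0 1 = - \<mu>\<^sub>2 * q 0 1 + lam * (1 - q 0 0) ^ d"
    using step[of 0 1] assms(2) by (simp_all add: FL_rhs_def algebra_simps)
  show "rhs q 1 0 = - \<mu>\<^sub>1 * q 1 0 + lam * (1 - (1 - q 0 0) ^ d)"
    using step[of 1 0] assms(2) by (simp add: FL_rhs_def numeral_2_eq_2 algebra_simps)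
  show *: "rhs q i j = - \<mu>\<^sub>1 * (tail q i j - tail q (Suc i) j)" if "decaying i j"
    using that assms(2) exhaust_two[of j]
    by (auto simp: FL_rhs_def decaying_def numeral_2_eq_2 algebra_simps Let_def)
  show "rhs q i j = - \<mu>\<^sub>1 * q i j" if "decaying i j"
    using *[OF that] step[of i j] by simp
qed

text \<open>Both sides are the stationary value of \<open>q 1 0\<close>: the left one by
  conservation of mass once \<open>q 0 1 = lam / \<mu>\<^sub>2 * u ^ d\<close>, the right one from
  its own balance equation.\<close>

lemma root_eqn_iff: "root_eqn u = 0 \<longleftrightarrow> u - lam / \<mu>\<^sub>2 * u ^ d = lam / \<mu>\<^sub>1 * (1 - u ^ d)"
  by (auto simp: fixpoint_eqn_def algebra_simps)

lemma root_bounds: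
  assumes "0 < u" "u < 1" "root_eqn u = 0"
  shows "0 < lam / \<mu>\<^sub>2 * u ^ d" "lam / \<mu>\<^sub>2 * u ^ d < u"
proof -
  show "0 < lam / \<mu>\<^sub>2 * u ^ d" using assms pos by simp
  have "u ^ d < 1" using assms params by (intro power_less_one_iff[THEN iffD2]) auto
  then have "0 < lam / \<mu>\<^sub>1 * (1 - u ^ d)" using pos by simp
  then show "lam / \<mu>\<^sub>2 * u ^ d < u" using assms(3) unfolding root_eqn_iff by linarith
qed

text \<open>Stationarity of a decaying tail forces its entry \<open>q i j\<close> to vanish. The
  remaining equations express \<open>q 0 1\<close> and \<open>q 1 0\<close> through
  \<open>u\<close>, and total mass 1 becomes the polynomial equation.\<close>

lemma fixed_point_iff:
  "FL_fixed_point lam \<mu>\<^sub>1 \<mu>\<^sub>2 d q \<and> q 0 0 > 0 \<longleftrightarrow>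
    (\<exists>u. 0 \<le> u \<and> u < 1 \<and> root_eqn u = 0 \<and> q = three_point u (lam / \<mu>\<^sub>2 * u ^ d))"
proof safe
  assume fp: "FL_fixed_point lam \<mu>\<^sub>1 \<mu>\<^sub>2 d q" and q00: "q 0 0 > 0"
  have state: "is_state q" and rhs: "rhs q i j = 0" for i j
    using fp by (auto simp: FL_fixed_point_def)
  note idle = rhs_idle[OF state q00]
  define u where "u = 1 - q 0 0"
  have zero: "q i j = 0" if "decaying i j" for i j
    using idle(5)[OF that] rhs[of i j] pos by simp
  have tails: "tail q 1 1 = 0" "tail q 2 0 = 0"
    unfolding tail_def by (auto intro!: infsum_0 zero simp: decaying_def)
  have q01: "q 0 1 = lam / \<mu>\<^sub>2 * u ^ d" and q10: "q 1 0 = lam / \<mu>\<^sub>1 * (1 - u ^ d)"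
    using idle(1,3) rhs pos by (simp_all add: u_def field_simps)
  have sum: "q 1 0 = u - q 0 1" using coordinates[OF state] tails by (simp add: u_def)
  have "q = three_point u (lam / \<mu>\<^sub>2 * u ^ d)"
  proof (intro ext)
    fix i j
    consider "i = 0" "j = 0" | "i = 0" "j = 1" | "i = 1" "j = 0" | "decaying i j"
      using exhaust_two[of j] unfolding decaying_def by fastforce
    then show "q i j = three_point u (lam / \<mu>\<^sub>2 * u ^ d) i j"
    proof cases
      case 4
      then show ?thesis using zero by (auto simp: decaying_def three_point_def)
    qed (use q01 sum in \<open>simp_all add: u_def\<close>)
  qed
  moreover have "0 \<le> u" "u < 1" using coordinates(4)[OF state] q00 by (auto simp: u_def)
  moreover have "root_eqn u = 0" unfolding root_eqn_iff using q01 q10 sum by simp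
  ultimately show "\<exists>u. 0 \<le> u \<and> u < 1 \<and> root_eqn u = 0 \<and> q = three_point u (lam / \<mu>\<^sub>2 * u ^ d)"
    by blast
next
  fix u assume u: "0 \<le> u" "u < 1" "root_eqn u = 0"
  then have "u \<noteq> 0" using pos params by (auto simp: fixpoint_eqn_def power_0_left)
  then have "0 < u" using u by simp
  define v where "v = lam / \<mu>\<^sub>2 * u ^ d"
  have v: "0 < v" "v < u" using root_bounds[OF \<open>0 < u\<close> u(2,3)] by (auto simp: v_def)
  have state: "is_state (three_point u v)" using u v by (intro three_point_state) auto
  have q00: "three_point u v 0 0 > 0" using u by simp
  note idle = rhs_idle[OF state q00]
  have "rhs (three_point u v) i j = 0" for i j
  proof -
    consider "i = 0" "j = 0" | "i = 0" "j = 1" | "i = 1" "j = 0" | "decaying i j"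
      using exhaust_two[of j] unfolding decaying_def by fastforce
    then show ?thesis
    proof cases
      case 3
      have "u - v = lam / \<mu>\<^sub>1 * (1 - u ^ d)" using u(3) unfolding root_eqn_iff v_def .
      then show ?thesis using 3 idle(3) pos by simp
    next
      case 4
      moreover from 4 have "three_point u v i j = 0" by (auto simp: decaying_def three_point_def)
      ultimately show ?thesis using idle(5) by simp
    qed (use idle(1,2) pos in \<open>simp_all add: v_def\<close>)
  qed
  then show "FL_fixed_point lam \<mu>\<^sub>1 \<mu>\<^sub>2 d (three_point u (lam / \<mu>\<^sub>2 * u ^ d))"
    using state by (simp add: FL_fixed_point_def v_def)
qed auto

text \<open>\<open>1 - q 0 0\<close> is \<open>tail q 1 0 + tail q 0 1\<close>, so its equation is
  the sum of two tail equations. Eliminating \<open>q 0 1\<close> and \<open>q 1 0\<close> in favour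
  of the coordinates leaves the planar system with a nonnegative forcing.\<close>

lemma solution_derivs:
  assumes "solution S q" "t \<in> S" "q t 0 0 > 0"
  shows "((\<lambda>s. 1 - q s 0 0) has_real_derivative lam - \<mu>\<^sub>1 * (1 - q t 0 0)
      + (\<mu>\<^sub>1 - \<mu>\<^sub>2) * tail (q t) 0 1 + (\<mu>\<^sub>1 * tail (q t) 2 0 + \<mu>\<^sub>2 * tail (q t) 1 1)) (at t within S)"
    and "((\<lambda>s. tail (q s) 0 1) has_real_derivative lam * (1 - q t 0 0) ^ d
      - \<mu>\<^sub>2 * tail (q t) 0 1 + \<mu>\<^sub>2 * tail (q t) 1 1) (at t within S)"
    and "decaying i j \<Longrightarrow> ((\<lambda>s. tail (q s) i j) has_real_derivative
      - \<mu>\<^sub>1 * (tail (q t) i j - tail (q t) (Suc i) j)) (at t within S)"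
proof -
  have state: "is_state (q s)" if "s \<in> S" for s using that assms(1) by (simp add: FL_solution_def)
  have deriv: "((\<lambda>s. tail (q s) i j) has_real_derivative rhs (q t) i j) (at t within S)" for i j
    using assms(1,2) by (simp add: FL_solution_def)
  note idle = rhs_idle[OF state[OF assms(2)] assms(3)]
  note co = coordinates[OF state]
  have "((\<lambda>s. tail (q s) 1 0 + tail (q s) 0 1) has_real_derivative rhs (q t) 1 0 + rhs (q t) 0 1)
      (at t within S)"
    by (intro derivative_intros deriv)
  then have "((\<lambda>s. 1 - q s 0 0) has_real_derivative rhs (q t) 1 0 + rhs (q t) 0 1) (at t within S)"
    by (rule has_field_derivative_transform_within[where d = 1]) (use assms(2) co(3) in auto)
  moreover have "rhs (q t) 1 0 + rhs (q t) 0 1 = lam - \<mu>\<^sub>1 * (1 - q t 0 0)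
      + (\<mu>\<^sub>1 - \<mu>\<^sub>2) * tail (q t) 0 1 + (\<mu>\<^sub>1 * tail (q t) 2 0 + \<mu>\<^sub>2 * tail (q t) 1 1)"
    unfolding idle co(1,2)[OF assms(2)] by (simp add: algebra_simps)
  ultimately show "((\<lambda>s. 1 - q s 0 0) has_real_derivative lam - \<mu>\<^sub>1 * (1 - q t 0 0)
      + (\<mu>\<^sub>1 - \<mu>\<^sub>2) * tail (q t) 0 1 + (\<mu>\<^sub>1 * tail (q t) 2 0 + \<mu>\<^sub>2 * tail (q t) 1 1)) (at t within S)"
    by simp
  have "rhs (q t) 0 1 = lam * (1 - q t 0 0) ^ d - \<mu>\<^sub>2 * tail (q t) 0 1 + \<mu>\<^sub>2 * tail (q t) 1 1"
    unfolding idle co(1)[OF assms(2)] by (simp add: algebra_simps)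
  then show "((\<lambda>s. tail (q s) 0 1) has_real_derivative lam * (1 - q t 0 0) ^ d
      - \<mu>\<^sub>2 * tail (q t) 0 1 + \<mu>\<^sub>2 * tail (q t) 1 1) (at t within S)"
    using deriv[of 0 1] by simp
  show "((\<lambda>s. tail (q s) i j) has_real_derivative
      - \<mu>\<^sub>1 * (tail (q t) i j - tail (q t) (Suc i) j)) (at t within S)" if "decaying i j"
    using deriv[of i j] idle(4)[OF that] by simp
qed

lemma solution_continuous:
  assumes "solution S q"
  shows "continuous_on S (\<lambda>t. tail (q t) i j)" "continuous_on S (\<lambda>t. 1 - q t 0 0)"
proof -
  show *: "continuous_on S (\<lambda>t. tail (q t) i j)" for i j
    using assms by (intro DERIV_continuous_on) (auto simp: FL_solution_def)
  have "continuous_on S (\<lambda>t. tail (q t) 1 0 + tail (q t) 0 1)" by (intro continuous_intros *)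
  then show "continuous_on S (\<lambda>t. 1 - q t 0 0)"
    by (rule continuous_on_eq)
      (use assms coordinates(3) in \<open>auto simp: FL_solution_def\<close>)
qed

lemma solution_subset:
  assumes "solution S q" "T \<subseteq> S"
  shows "solution T q"
  using assms unfolding FL_solution_def by (blast intro: has_field_derivative_subset)

text \<open>The candidate for \<open>tail\<close> at time \<open>t\<close> of a solution started in
  \<open>q\<close>, intended for decaying indices. Being explicit, it serves as a known forcing of
  the planar system.\<close>

definition decay :: "family \<Rightarrow> nat \<Rightarrow> 2 \<Rightarrow> real \<Rightarrow> real" where
  "decay q i j = death \<mu>\<^sub>1 (\<lambda>i. tail q i j) i"

context
  fixes q :: family
  assumes state: "is_state q"
begin

lemma abs_tail_le_1: "\<bar>tail q i j\<bar> \<le> 1"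
  using state_tail_nonneg[OF state, of i j] state_tail_le_1[OF state, of i j] by simp

lemma decay_deriv:
  "(decay q i j has_real_derivative - \<mu>\<^sub>1 * (decay q i j t - decay q (Suc i) j t)) (at t within S)"
  unfolding decay_def using death_deriv[of "\<lambda>i. tail q i j", OF abs_tail_le_1]
  by (rule has_field_derivative_at_within)

lemma decay_bounds:
  assumes "0 \<le> t"
  shows "0 \<le> decay q i j t" "decay q i j t \<le> tail q i j" "decay q (Suc i) j t \<le> decay q i j t"
proof -
  have t: "0 \<le> \<mu>\<^sub>1 * t" using assms pos by simp
  note bounds = death_bounds[of "\<lambda>i. tail q i j", OF abs_tail_le_1 _ _ t, of i "tail q i j"]
  show "0 \<le> decay q i j t" "decay q i j t \<le> tail q i j"
    unfolding decay_def using state_tail_nonneg[OF state] state_tail_antimono[OF state]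
    by (intro bounds; simp)+
  show "decay q (Suc i) j t \<le> decay q i j t"
    unfolding decay_def using state_tail_antimono[OF state]
    by (intro death_mono[of "\<lambda>i. tail q i j", OF abs_tail_le_1 _ t]) simp
qed

lemma decay_0 [simp]: "decay q i j 0 = tail q i j"
  unfolding decay_def by (rule death_0)

text \<open>
  Truncating \<open>u\<close> makes the planar system globally Lipschitz; the solutions used below stay
  where the truncation is inactive.
\<close>
lemma planar_solution:
  assumes "0 \<le> w" "w \<le> 1"
  obtains u V where "u 0 = 1 - q 0 0" "V 0 = tail q 0 1"
    "\<And>t. 0 \<le> t \<Longrightarrow> (u has_real_derivative lam - \<mu>\<^sub>1 * u t + (\<mu>\<^sub>1 - \<mu>\<^sub>2) * V t
        + (\<mu>\<^sub>1 * decay q 2 0 t + \<mu>\<^sub>2 * decay q 1 1 t)) (at t within {0..})"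
    "\<And>t. 0 \<le> t \<Longrightarrow> (V has_real_derivative lam * max 0 (min w (u t)) ^ d - \<mu>\<^sub>2 * V t
        + \<mu>\<^sub>2 * decay q 1 1 t) (at t within {0..})"
proof -
  define cut where "cut = (\<lambda>x. max 0 (min w x))"
  define G where "G = (\<lambda>(x, y). (lam - \<mu>\<^sub>1 * x + (\<mu>\<^sub>1 - \<mu>\<^sub>2) * y, lam * cut x ^ d - \<mu>\<^sub>2 * y))"
  define h where "h = (\<lambda>t. (\<mu>\<^sub>1 * decay q 2 0 t + \<mu>\<^sub>2 * decay q 1 1 t, \<mu>\<^sub>2 * decay q 1 1 t))"
  \<comment> \<open>Sum of the sizes of the coefficients; \<open>real d\<close> is the Lipschitz
    constant of the power on the unit interval, where \<open>cut\<close> takes its values.\<close>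
  define L where "L = \<mu>\<^sub>1 + (\<mu>\<^sub>1 - \<mu>\<^sub>2) + lam * real d + \<mu>\<^sub>2"
  have "L > 0" using pos unfolding L_def by (simp add: add_pos_nonneg)
  have lip: "norm (G z - G z') \<le> L * norm (z - z')" for z z'
  proof -
    obtain x y x' y' where z: "z = (x, y)" "z' = (x', y')" by fastforce
    define N where "N = norm (z - z')"
    have N: "\<bar>x - x'\<bar> \<le> N" "\<bar>y - y'\<bar> \<le> N"
      using norm_fst_le[of "x - x'" "y - y'"] norm_snd_le[of "y - y'" "x - x'"] by (auto simp: z N_def)
    have "\<bar>cut x ^ d - cut x' ^ d\<bar> \<le> real d * 1 ^ (d - 1) * \<bar>cut x - cut x'\<bar>"
      by (rule power_diff_bound) (use assms in \<open>auto simp: cut_def\<close>)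
    also have "\<dots> \<le> real d * 1 ^ (d - 1) * N"
      using N(1) by (intro mult_left_mono) (auto simp: cut_def)
    finally have c: "\<bar>lam * (cut x ^ d - cut x' ^ d)\<bar> \<le> lam * real d * N"
      using pos by (simp add: abs_mult)
    have "norm (G z - G z') \<le> \<bar>- \<mu>\<^sub>1 * (x - x') + (\<mu>\<^sub>1 - \<mu>\<^sub>2) * (y - y')\<bar>
        + \<bar>lam * (cut x ^ d - cut x' ^ d) - \<mu>\<^sub>2 * (y - y')\<bar>"
    proof -
      have "G z - G z' = (- \<mu>\<^sub>1 * (x - x') + (\<mu>\<^sub>1 - \<mu>\<^sub>2) * (y - y'),
          lam * (cut x ^ d - cut x' ^ d) - \<mu>\<^sub>2 * (y - y'))"
        by (simp add: z G_def algebra_simps)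
      then show ?thesis using norm_Pair_le by (metis real_norm_def)
    qed
    also have "\<dots> \<le> \<bar>- \<mu>\<^sub>1 * (x - x')\<bar> + \<bar>(\<mu>\<^sub>1 - \<mu>\<^sub>2) * (y - y')\<bar>
        + (\<bar>lam * (cut x ^ d - cut x' ^ d)\<bar> + \<bar>\<mu>\<^sub>2 * (y - y')\<bar>)"
      by linarith
    also have "\<dots> \<le> \<mu>\<^sub>1 * N + (\<mu>\<^sub>1 - \<mu>\<^sub>2) * N + (lam * real d * N + \<mu>\<^sub>2 * N)"
      using N c pos by (intro add_mono) (auto simp: abs_mult intro!: mult_left_mono)
    finally show ?thesis by (simp add: N_def L_def algebra_simps)
  qed
  have cont: "continuous_on {0..} h"
  proof -
    have "continuous_on {0..} (decay q i j)" for i j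
      by (rule DERIV_continuous_on) (rule decay_deriv)
    then show ?thesis unfolding h_def by (intro continuous_intros)
  qed
  have bound: "norm (h t) \<le> \<mu>\<^sub>1 + \<mu>\<^sub>2 + \<mu>\<^sub>2" if "0 \<le> t" for t
  proof -
    have le: "0 \<le> decay q i j t" "decay q i j t \<le> 1" for i j
      using decay_bounds[OF that, of i j] state_tail_le_1[OF state, of i j] by auto
    have "norm (h t) \<le> \<bar>\<mu>\<^sub>1 * decay q 2 0 t + \<mu>\<^sub>2 * decay q 1 1 t\<bar> + \<bar>\<mu>\<^sub>2 * decay q 1 1 t\<bar>"
      unfolding h_def using norm_Pair_le by (metis real_norm_def)
    also have "\<dots> = \<mu>\<^sub>1 * decay q 2 0 t + \<mu>\<^sub>2 * decay q 1 1 t + \<mu>\<^sub>2 * decay q 1 1 t"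
      using le pos by simp
    also have "\<dots> \<le> \<mu>\<^sub>1 * 1 + \<mu>\<^sub>2 * 1 + \<mu>\<^sub>2 * 1"
      using le pos by (intro add_mono mult_left_mono) auto
    finally show ?thesis by simp
  qed
  obtain y where y: "y 0 = (1 - q 0 0, tail q 0 1)"
    "\<And>t. 0 \<le> t \<Longrightarrow> (y has_vector_derivative G (y t) + h t) (at t within {0..})"
    using lipschitz_ode_exists[OF \<open>L > 0\<close> lip cont bound] by blast
  show ?thesis
  proof (rule that[of "\<lambda>t. fst (y t)" "\<lambda>t. snd (y t)"])
    fix t :: real assume t: "0 \<le> t"
    have "((\<lambda>t. fst (y t)) has_vector_derivative fst (G (y t) + h t)) (at t within {0..})"
      by (rule bounded_linear.has_vector_derivative[OF bounded_linear_fst y(2)[OF t]])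
    then show "((\<lambda>t. fst (y t)) has_real_derivative lam - \<mu>\<^sub>1 * fst (y t) + (\<mu>\<^sub>1 - \<mu>\<^sub>2) * snd (y t)
        + (\<mu>\<^sub>1 * decay q 2 0 t + \<mu>\<^sub>2 * decay q 1 1 t)) (at t within {0..})"
      by (simp add: has_real_derivative_iff_has_vector_derivative G_def h_def case_prod_beta)
    have "((\<lambda>t. snd (y t)) has_vector_derivative snd (G (y t) + h t)) (at t within {0..})"
      by (rule bounded_linear.has_vector_derivative[OF bounded_linear_snd y(2)[OF t]])
    then show "((\<lambda>t. snd (y t)) has_real_derivative lam * max 0 (min w (fst (y t))) ^ d
        - \<mu>\<^sub>2 * snd (y t) + \<mu>\<^sub>2 * decay q 1 1 t) (at t within {0..})"
      by (simp add: has_real_derivative_iff_has_vector_derivative G_def h_def case_prod_beta cut_def)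
  qed (simp_all add: y(1))
qed

text \<open>Converse of the reduction to the plane. In the range condition, \<open>u t < 1\<close>
  is the idle region and orders the tails at \<open>(0, 0)\<close> and \<open>(1, 0)\<close>; the
  last two inequalities order the tails where the planar coordinates meet the decaying ones.
  Summability is inherited from the initial tails, which dominate \<open>decay\<close>.\<close>

lemma assemble_solution:
  assumes S: "S \<subseteq> {0..}" "0 \<in> S" and init: "u 0 = 1 - q 0 0" "V 0 = tail q 0 1"
    and range: "\<And>t. t \<in> S \<Longrightarrow> 0 \<le> u t \<and> u t < 1 \<and> decay q 1 1 t \<le> V t \<and> decay q 2 0 t \<le> u t - V t"
    and u: "\<And>t. t \<in> S \<Longrightarrow> (u has_real_derivative lam - \<mu>\<^sub>1 * u t + (\<mu>\<^sub>1 - \<mu>\<^sub>2) * V t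
        + (\<mu>\<^sub>1 * decay q 2 0 t + \<mu>\<^sub>2 * decay q 1 1 t)) (at t within S)"
    and V: "\<And>t. t \<in> S \<Longrightarrow> (V has_real_derivative lam * u t ^ d - \<mu>\<^sub>2 * V t
        + \<mu>\<^sub>2 * decay q 1 1 t) (at t within S)"
  obtains r where "solution S r" "r 0 = q" "\<And>t. t \<in> S \<Longrightarrow> 1 - r t 0 0 = u t \<and> tail (r t) 0 1 = V t"
proof -
  define Q :: "real \<Rightarrow> family" where "Q = (\<lambda>t i j.
    if decaying i j then decay q i j t
    else if i = 0 then if j = 0 then 1 - V t else V t else u t - V t)"
  define r where "r = (\<lambda>t i j. Q t i j - Q t (Suc i) j)"
  have Q: "Q t 0 0 = 1 - V t" "Q t 0 1 = V t" "Q t 1 0 = u t - V t" "Q t (Suc 0) 0 = u t - V t"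
    "decaying i j \<Longrightarrow> Q t i j = decay q i j t" for t i j
    by (auto simp: Q_def decaying_def)
  have dec: "decaying 1 1" "decaying (Suc 0) 1" "decaying 2 0" "decaying (Suc (Suc 0)) 0"
    "decaying i j \<Longrightarrow> decaying (Suc i) j" for i j
    by (auto simp: decaying_def)
  have cases: "(i = 0 \<and> j = 0) \<or> (i = 0 \<and> j = 1) \<or> (i = 1 \<and> j = 0) \<or> decaying i j" for i j
    using exhaust_two[of j] unfolding decaying_def by fastforce
  have st: "is_state (r t) \<and> tail (r t) = Q t" if "t \<in> S" for t
  proof -
    have t: "0 \<le> t" using S that by auto
    note b = range[OF that] decay_bounds[OF t]
    have "Q t (Suc i) j \<le> Q t i j" for i j
      using cases[of i j] b(1) b(4)[of i j] by (auto simp: Q dec numeral_2_eq_2)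
    moreover have "(\<lambda>i. Q t i j) \<longlonglongrightarrow> 0" for j
    proof (rule tendsto_sandwich[OF _ _ tendsto_const state_tail_tendsto_0[OF state]])
      have ev: "\<forall>\<^sub>F i in sequentially. Q t i j = decay q i j t"
        using eventually_ge_at_top[of 2] by eventually_elim (auto simp: Q decaying_def)
      show "\<forall>\<^sub>F i in sequentially. 0 \<le> Q t i j"
        using ev by eventually_elim (simp add: b)
      show "\<forall>\<^sub>F i in sequentially. Q t i j \<le> tail q i j"
        using ev by eventually_elim (simp add: b)
    qed
    moreover have "Q t 0 0 + Q t 0 1 = 1" by (simp add: Q)
    ultimately show ?thesis unfolding r_def by (intro conjI state_of_tails)
  qed
  have r00: "r t 0 0 = 1 - u t" for t by (simp add: r_def Q)
  have "solution S r"
    unfolding FL_solution_def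
  proof (intro conjI ballI allI)
    fix t i j assume t: "t \<in> S"
    show state_t: "is_state (r t)" using st[OF t] by simp
    have r00_pos: "r t 0 0 > 0" using range[OF t] by (simp add: r00)
    note idle = rhs_idle[OF state_t r00_pos]
    have *: "((\<lambda>s. tail (r s) i j) has_real_derivative rhs (r t) i j) (at t within S)"
      if "(Q' has_real_derivative rhs (r t) i j) (at t within S)" "\<And>s. s \<in> S \<Longrightarrow> Q' s = Q s i j" for Q'
      by (rule has_field_derivative_transform_within[OF that(1), of 1]) (use st t that(2) in auto)
    have r: "r t 0 1 = V t - decay q 1 1 t" "r t 1 0 = u t - V t - decay q 2 0 t"
      "1 - r t 0 0 = u t" by (simp_all add: r_def Q dec numeral_2_eq_2)
    from cases[of i j] show "((\<lambda>s. tail (r s) i j) has_real_derivative rhs (r t) i j) (at t within S)"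
    proof (elim disjE conjE)
      assume [simp]: "i = 0" "j = 0"
      show ?thesis
        by (rule *[of "\<lambda>s. 1 - V s"], unfold \<open>i = 0\<close> \<open>j = 0\<close> idle r)
          (auto intro!: derivative_eq_intros V[OF t] simp: Q algebra_simps)
    next
      assume [simp]: "i = 0" "j = 1"
      show ?thesis
        by (rule *[of V], unfold \<open>i = 0\<close> \<open>j = 1\<close> idle r)
          (auto intro!: derivative_eq_intros DERIV_cong[OF V[OF t]] simp: Q algebra_simps)
    next
      assume [simp]: "i = 1" "j = 0"
      show ?thesis
        by (rule *[of "\<lambda>s. u s - V s"], unfold \<open>i = 1\<close> \<open>j = 0\<close> idle r)
          (auto intro!: derivative_eq_intros u[OF t] V[OF t] simp: Q algebra_simps)
    next
      assume ij: "decaying i j"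
      have "rhs (r t) i j = - \<mu>\<^sub>1 * (decay q i j t - decay q (Suc i) j t)"
        using idle(4)[OF ij] st[OF t] ij dec(5)[OF ij] by (simp add: Q)
      then show ?thesis
        using decay_deriv[of i j t S] by (intro *[of "decay q i j"]) (auto simp: Q ij)
    qed
  qed
  moreover have "r 0 = q"
  proof -
    have Q0: "Q 0 i j = tail q i j" for i j
      using cases[of i j] init coordinates[OF state] state_tail_sum[OF state] by (auto simp: Q)
    show ?thesis
    proof (intro ext)
      show "r 0 i j = q i j" for i j using state_tail_step[OF state, of i j] by (simp add: r_def Q0)
    qed
  qed
  ultimately show ?thesis
    using that[of r] st r00 by (simp add: Q)
qed

end

text \<open>The unforced planar equations at rest; subtracting them rewrites the vector field in
  deviations from the equilibrium.\<close>

lemma equilibrium_eqns: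
  assumes "root_eqn u0 = 0"
  defines "v0 \<equiv> lam / \<mu>\<^sub>2 * u0 ^ d"
  shows "lam * u0 ^ d = \<mu>\<^sub>2 * v0" "lam = \<mu>\<^sub>1 * u0 - (\<mu>\<^sub>1 - \<mu>\<^sub>2) * v0"
proof -
  show *: "lam * u0 ^ d = \<mu>\<^sub>2 * v0" using pos by (simp add: v0_def)
  have "\<mu>\<^sub>1 * (u0 - v0) = \<mu>\<^sub>1 * (lam / \<mu>\<^sub>1 * (1 - u0 ^ d))"
    using assms(1) unfolding root_eqn_iff v0_def by simp
  then show "lam = \<mu>\<^sub>1 * u0 - (\<mu>\<^sub>1 - \<mu>\<^sub>2) * v0" using pos * by (simp add: algebra_simps)
qed

section \<open>Decay of the tails along arbitrary solutions\<close>

lemma solution_decreasing: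
  assumes "solution S q" "{a..b} \<subseteq> S" "a \<le> b" "\<And>t. a < t \<Longrightarrow> t < b \<Longrightarrow> 0 < q t 0 0" "decaying i j"
  shows "tail (q b) i j \<le> tail (q a) i j"
proof -
  \<comment> \<open>Gronwall with rate 0 states monotonicity.\<close>
  have "tail (q b) i j - 0 \<le> (tail (q a) i j - 0) * exp (- 0 * (b - a))"
  proof (rule gronwall[OF \<open>a \<le> b\<close>])
    show "continuous_on {a..b} (\<lambda>t. tail (q t) i j)"
      by (rule continuous_on_subset[OF solution_continuous(1)[OF assms(1)] assms(2)])
    fix t assume t: "a < t" "t < b"
    then have "t \<in> S" using assms(2) by auto
    moreover have "at t within S = at t" by (rule at_within_interval[OF t assms(2)])
    moreover have "is_state (q t)" using assms(1) \<open>t \<in> S\<close> by (simp add: FL_solution_def)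
    then have "tail (q t) (Suc i) j \<le> tail (q t) i j" by (rule state_tail_antimono) simp
    ultimately show "\<exists>D. ((\<lambda>t. tail (q t) i j) has_real_derivative D) (at t) \<and> D \<le> 0 * (0 - tail (q t) i j)"
      using solution_derivs(3)[OF assms(1) \<open>t \<in> S\<close> assms(4)[OF t] assms(5)] pos
      by (intro exI[of _ "- \<mu>\<^sub>1 * (tail (q t) i j - tail (q t) (Suc i) j)"]) simp
  qed
  then show ?thesis by simp
qed

text \<open>
  The decay is not uniform in the initial state, hence the detour through a level \<open>N\<close> at which
  the initial tail is already small.
\<close>
lemma solution_tail_tendsto_0:
  assumes "solution {0..} q" "\<And>t. 0 \<le> t \<Longrightarrow> 0 < q t 0 0" "decaying i j" "0 < e"
  shows "\<forall>\<^sub>F t in at_top. tail (q t) i j < e"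
proof -
  have state: "is_state (q t)" if "0 \<le> t" for t using assms(1) that by (simp add: FL_solution_def)
  have "\<forall>\<^sub>F N in sequentially. tail (q 0) N j < e"
    using order_tendstoD(2)[OF state_tail_tendsto_0[OF state]] \<open>0 < e\<close> by simp
  then have "\<forall>\<^sub>F N in sequentially. tail (q 0) N j < e \<and> i \<le> N"
    using eventually_ge_at_top[of i] by eventually_elim simp
  then obtain N where N: "tail (q 0) N j < e" "i \<le> N"
    unfolding eventually_sequentially by blast
  define m where "m = tail (q 0) N j"
  have mono: "decaying i' j" if "i \<le> i'" for i' using that assms(3) by (auto simp: decaying_def)
  \<comment> \<open>Downward induction from \<open>N\<close> to \<open>i\<close>: each tail relaxes
    towards the next one, so the upper limit \<open>m\<close> descends level by level.\<close>
  have "\<And>e. m < e \<Longrightarrow> \<forall>\<^sub>F t in at_top. tail (q t) i j < e"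
    using \<open>i \<le> N\<close>
  proof (induction rule: inc_induct)
    case base
    have "\<forall>\<^sub>F t in at_top. tail (q t) N j \<le> m"
      using eventually_ge_at_top[of 0]
    proof eventually_elim
      case (elim t)
      then show ?case unfolding m_def
        using mono[OF N(2)] by (intro solution_decreasing[OF assms(1)] assms(2)) auto
    qed
    then show ?case using base by (auto elim: eventually_mono)
  next
    case (step n)
    show ?case
    proof (rule relaxation_eventually_less[OF pos(2), of 0 _ "\<lambda>t. tail (q t) (Suc n) j"])
      fix t :: real assume "0 < t"
      moreover from this have "at t within {0..} = at t"
        by (intro at_within_interval[of 0 t "t + 1"]) auto
      ultimately have "((\<lambda>t. tail (q t) n j) has_real_derivative - \<mu>\<^sub>1 * (tail (q t) n j - tail (q t) (Suc n) j)) (at t)"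
        using solution_derivs(3)[OF assms(1) _ assms(2) mono[OF step(1)], of t] by auto
      then show "\<exists>D. ((\<lambda>t. tail (q t) n j) has_real_derivative D) (at t) \<and>
          D \<le> \<mu>\<^sub>1 * (tail (q t) (Suc n) j - tail (q t) n j)"
        by (intro exI conjI) (auto simp: algebra_simps)
    qed (use step in auto)
  qed
  then show ?thesis using N by (simp add: m_def)
qed

end

section \<open>Stability\<close>

text \<open>
  \<open>w\<close> lies so close to \<open>u0\<close> that the Lyapunov inequality still holds when the derivative of
  \<open>lam * u ^ d\<close> at \<open>u0\<close> is replaced by its value at \<open>w\<close>, its maximum on \<open>{0..w}\<close>.
\<close>
locale FL_lower_root = FL +
  fixes u0 w k C slope v0 :: real
  assumes u0: "0 < u0" "u0 < w" "w < 1" "root_eqn u0 = 0"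
    and kC: "0 < k" "0 \<le> C"
    and slope_def: "slope = lam * (real d * w ^ (d - 1))"
    and v0_def: "v0 = lam / \<mu>\<^sub>2 * u0 ^ d"
    and lyapunov: "\<And>x y n g h \<rho>. \<bar>n\<bar> \<le> slope * \<bar>x\<bar> \<Longrightarrow> \<bar>g\<bar> \<le> \<mu>\<^sub>1 * \<rho> \<Longrightarrow> \<bar>h\<bar> \<le> \<mu>\<^sub>2 * \<rho> \<Longrightarrow>
      2 * slope * x * (- \<mu>\<^sub>1 * x + (\<mu>\<^sub>1 - \<mu>\<^sub>2) * y + g) + 2 * (\<mu>\<^sub>1 - \<mu>\<^sub>2) * y * (n - \<mu>\<^sub>2 * y + h)
        \<le> k * (C * \<rho>\<^sup>2 - (slope * x\<^sup>2 + (\<mu>\<^sub>1 - \<mu>\<^sub>2) * y\<^sup>2))"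
begin

section \<open>Energy estimates near the lower root\<close>

definition energy :: "real \<Rightarrow> real \<Rightarrow> real" where
  "energy x y = slope * (x - u0)\<^sup>2 + (\<mu>\<^sub>1 - \<mu>\<^sub>2) * (y - v0)\<^sup>2"

lemma slope_pos: "0 < slope"
  using u0 pos params by (simp add: slope_def)

lemma v0: "0 < v0" "v0 < u0"
  using root_bounds[of u0] u0 by (simp_all add: v0_def)

text \<open>\<open>\<phi>\<close> stands for \<open>u t ^ d\<close> along a genuine solution and for
  the power of the truncated \<open>u t\<close> in the auxiliary system; only its Lipschitz bound at
  the equilibrium matters.\<close>

lemma energy_deriv:
  assumes u: "(u has_real_derivative lam - \<mu>\<^sub>1 * u t + (\<mu>\<^sub>1 - \<mu>\<^sub>2) * V t + (\<mu>\<^sub>1 * B + \<mu>\<^sub>2 * A)) (at t)"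
    and V: "(V has_real_derivative lam * \<phi> - \<mu>\<^sub>2 * V t + \<mu>\<^sub>2 * A) (at t)"
    and \<phi>: "\<bar>\<phi> - u0 ^ d\<bar> \<le> real d * w ^ (d - 1) * \<bar>u t - u0\<bar>"
    and AB: "0 \<le> A" "0 \<le> B" "A + B \<le> \<rho>"
  shows "\<exists>D. ((\<lambda>t. energy (u t) (V t)) has_real_derivative D) (at t)
    \<and> D \<le> k * (C * \<rho>\<^sup>2 - energy (u t) (V t))"
proof -
  define x where "x = u t - u0"
  define y where "y = V t - v0"
  define n where "n = lam * (\<phi> - u0 ^ d)"
  define g where "g = \<mu>\<^sub>1 * B + \<mu>\<^sub>2 * A"
  define h where "h = \<mu>\<^sub>2 * A"
  note eq = equilibrium_eqns[OF u0(4), folded v0_def]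
  define D where "D = 2 * slope * x * (- \<mu>\<^sub>1 * x + (\<mu>\<^sub>1 - \<mu>\<^sub>2) * y + g)
        + 2 * (\<mu>\<^sub>1 - \<mu>\<^sub>2) * y * (n - \<mu>\<^sub>2 * y + h)"
  have u': "lam - \<mu>\<^sub>1 * u t + (\<mu>\<^sub>1 - \<mu>\<^sub>2) * V t + (\<mu>\<^sub>1 * B + \<mu>\<^sub>2 * A) = - \<mu>\<^sub>1 * x + (\<mu>\<^sub>1 - \<mu>\<^sub>2) * y + g"
    using eq(2) by (simp add: x_def y_def g_def algebra_simps)
  have V': "lam * \<phi> - \<mu>\<^sub>2 * V t + \<mu>\<^sub>2 * A = n - \<mu>\<^sub>2 * y + h"
    using eq(1) by (simp add: n_def y_def h_def algebra_simps)
  have "((\<lambda>t. energy (u t) (V t)) has_real_derivative D) (at t)"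
    unfolding energy_def
    by (auto intro!: derivative_eq_intros u[unfolded u'] V[unfolded V'] simp: D_def x_def[symmetric] y_def[symmetric])
  moreover have "D \<le> k * (C * \<rho>\<^sup>2 - energy (u t) (V t))"
    unfolding D_def energy_def x_def[symmetric] y_def[symmetric]
  proof (rule lyapunov)
    show "\<bar>n\<bar> \<le> slope * \<bar>x\<bar>"
      using mult_left_mono[OF \<phi>, of lam] pos by (simp add: slope_def n_def x_def abs_mult mult.assoc)
    have "0 \<le> \<mu>\<^sub>1 * B" "0 \<le> \<mu>\<^sub>2 * A" using AB pos by simp_all
    moreover have "\<mu>\<^sub>2 * A \<le> \<mu>\<^sub>1 * A" "\<mu>\<^sub>1 * (A + B) \<le> \<mu>\<^sub>1 * \<rho>" "\<mu>\<^sub>2 * A \<le> \<mu>\<^sub>2 * \<rho>"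
      using AB pos by (intro mult_right_mono mult_left_mono; linarith)+
    ultimately show "\<bar>g\<bar> \<le> \<mu>\<^sub>1 * \<rho>" "\<bar>h\<bar> \<le> \<mu>\<^sub>2 * \<rho>"
      by (simp_all add: g_def h_def distrib_left)
  qed
  ultimately show ?thesis by blast
qed

text \<open>Above the level \<open>C * \<rho>\<^sup>2\<close> dissipation beats the forcing, so the
  energy can exceed neither that level nor its initial value, whichever is larger.\<close>

lemma energy_bound:
  assumes "0 \<le> T" "continuous_on {0..T} u" "continuous_on {0..T} V"
    and "\<And>t. 0 < t \<Longrightarrow> t < T \<Longrightarrow> \<exists>D. ((\<lambda>t. energy (u t) (V t)) has_real_derivative D) (at t)
      \<and> D \<le> k * (C * \<rho>\<^sup>2 - energy (u t) (V t))"
  shows "energy (u T) (V T) \<le> max (energy (u 0) (V 0)) (C * \<rho>\<^sup>2)"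
proof -
  define E where "E = (\<lambda>t. energy (u t) (V t))"
  define m where "m = C * \<rho>\<^sup>2"
  have "continuous_on {0..T} E" unfolding E_def energy_def by (intro continuous_intros assms)
  then have *: "E T - m \<le> (E 0 - m) * exp (- k * (T - 0))"
    by (rule gronwall[OF assms(1)]) (use assms(4) in \<open>simp add: E_def m_def\<close>)
  have e: "exp (- k * (T - 0)) \<le> 1" using kC assms(1) by simp
  have "E T \<le> max (E 0) m"
  proof (cases "E 0 \<le> m")
    case True
    then have "(E 0 - m) * exp (- k * (T - 0)) \<le> 0" by (intro mult_nonpos_nonneg) auto
    then show ?thesis using * by simp
  next
    case False
    then have "(E 0 - m) * exp (- k * (T - 0)) \<le> E 0 - m" using e by (intro mult_left_le) auto
    then show ?thesis using * by simp
  qed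
  then show ?thesis by (simp add: E_def m_def)
qed

text \<open>The largest level whose open sublevel ellipse fits into the square of half-width
  \<open>\<eta>\<close> about the equilibrium.\<close>

definition threshold :: "real \<Rightarrow> real" where
  "threshold \<eta> = min slope (\<mu>\<^sub>1 - \<mu>\<^sub>2) * \<eta>\<^sup>2"

lemma threshold_pos: "0 < \<eta> \<Longrightarrow> 0 < threshold \<eta>"
  using slope_pos pos by (simp add: threshold_def)

lemma energy_small:
  assumes "0 < \<eta>" "energy x y < threshold \<eta>"
  shows "\<bar>x - u0\<bar> < \<eta>" "\<bar>y - v0\<bar> < \<eta>"
proof -
  define m where "m = min slope (\<mu>\<^sub>1 - \<mu>\<^sub>2)"
  have m: "0 < m" "m \<le> slope" "m \<le> \<mu>\<^sub>1 - \<mu>\<^sub>2" using slope_pos pos by (auto simp: m_def)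
  have "m * (x - u0)\<^sup>2 \<le> slope * (x - u0)\<^sup>2" "m * (y - v0)\<^sup>2 \<le> (\<mu>\<^sub>1 - \<mu>\<^sub>2) * (y - v0)\<^sup>2"
    "0 \<le> slope * (x - u0)\<^sup>2" "0 \<le> (\<mu>\<^sub>1 - \<mu>\<^sub>2) * (y - v0)\<^sup>2"
    using m slope_pos pos by (auto intro: mult_right_mono)
  then have "m * (x - u0)\<^sup>2 < m * \<eta>\<^sup>2" "m * (y - v0)\<^sup>2 < m * \<eta>\<^sup>2"
    using assms(2) unfolding energy_def threshold_def m_def[symmetric] by linarith+
  then have "\<bar>x - u0\<bar>\<^sup>2 < \<eta>\<^sup>2" "\<bar>y - v0\<bar>\<^sup>2 < \<eta>\<^sup>2" using m by simp_all
  from this[THEN power_less_imp_less_base] show "\<bar>x - u0\<bar> < \<eta>" "\<bar>y - v0\<bar> < \<eta>"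
    using assms(1) by simp_all
qed

lemma small_initial:
  assumes "0 < \<eta>"
  obtains \<delta> where "0 < \<delta>" "\<delta> \<le> \<eta>"
    "\<And>x y \<rho>. \<bar>x - u0\<bar> < \<delta> \<Longrightarrow> \<bar>y - v0\<bar> < \<delta> \<Longrightarrow> 0 \<le> \<rho> \<Longrightarrow> \<rho> < \<delta> \<Longrightarrow>
      max (energy x y) (C * \<rho>\<^sup>2) < threshold \<eta>"
proof -
  \<comment> \<open>\<open>K * \<delta>\<^sup>2\<close> bounds the initial energy and the forcing
    level simultaneously.\<close>
  define K where "K = slope + (\<mu>\<^sub>1 - \<mu>\<^sub>2) + C"
  have K: "0 < K" using slope_pos pos kC by (simp add: K_def)
  define \<delta> where "\<delta> = min \<eta> (sqrt (threshold \<eta> / K))"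
  have \<delta>: "0 < \<delta>" using assms threshold_pos[OF assms] K by (simp add: \<delta>_def)
  have "\<delta>\<^sup>2 \<le> (sqrt (threshold \<eta> / K))\<^sup>2" using \<delta> by (intro power_mono) (auto simp: \<delta>_def)
  also have "\<dots> = threshold \<eta> / K" using threshold_pos[OF assms] K by simp
  finally have K\<delta>: "K * \<delta>\<^sup>2 \<le> threshold \<eta>" using K by (simp add: field_simps)
  show ?thesis
  proof (rule that[OF \<delta>])
    show "\<delta> \<le> \<eta>" by (simp add: \<delta>_def)
    fix x y \<rho> :: real
    assume "\<bar>x - u0\<bar> < \<delta>" "\<bar>y - v0\<bar> < \<delta>" "0 \<le> \<rho>" "\<rho> < \<delta>"
    then have "\<bar>x - u0\<bar>\<^sup>2 < \<delta>\<^sup>2" "\<bar>y - v0\<bar>\<^sup>2 < \<delta>\<^sup>2" "\<rho>\<^sup>2 < \<delta>\<^sup>2"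
      by (intro power_strict_mono; simp)+
    then have *: "slope * (x - u0)\<^sup>2 < slope * \<delta>\<^sup>2" "(\<mu>\<^sub>1 - \<mu>\<^sub>2) * (y - v0)\<^sup>2 < (\<mu>\<^sub>1 - \<mu>\<^sub>2) * \<delta>\<^sup>2"
      "C * \<rho>\<^sup>2 \<le> C * \<delta>\<^sup>2" "0 \<le> C * \<delta>\<^sup>2" "0 < slope * \<delta>\<^sup>2" "0 < (\<mu>\<^sub>1 - \<mu>\<^sub>2) * \<delta>\<^sup>2"
      using slope_pos pos kC \<delta> by (auto intro: mult_left_mono)
    have "K * \<delta>\<^sup>2 = slope * \<delta>\<^sup>2 + (\<mu>\<^sub>1 - \<mu>\<^sub>2) * \<delta>\<^sup>2 + C * \<delta>\<^sup>2" by (simp add: K_def algebra_simps)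
    then have "energy x y < threshold \<eta>" "C * \<rho>\<^sup>2 < threshold \<eta>"
      unfolding energy_def using * K\<delta> by linarith+
    then show "max (energy x y) (C * \<rho>\<^sup>2) < threshold \<eta>" by simp
  qed
qed

lemma phi_bound:
  assumes "0 \<le> x" "x \<le> w"
  shows "\<bar>x ^ d - u0 ^ d\<bar> \<le> real d * w ^ (d - 1) * \<bar>x - u0\<bar>"
  using power_diff_bound[of x w u0 d] assms u0 by simp

lemma solution_energy_deriv:
  assumes q: "solution S q" "{0..T} \<subseteq> S" and t: "0 < t" "t < T" and less: "1 - q t 0 0 < w"
    and \<rho>: "tail (q t) 1 1 + tail (q t) 2 0 \<le> \<rho>"
  shows "\<exists>D. ((\<lambda>t. energy (1 - q t 0 0) (tail (q t) 0 1)) has_real_derivative D) (at t)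
      \<and> D \<le> k * (C * \<rho>\<^sup>2 - energy (1 - q t 0 0) (tail (q t) 0 1))"
proof -
  have tS: "t \<in> S" using t q(2) by auto
  have at: "at t within S = at t" by (rule at_within_interval[OF t q(2)])
  have state: "is_state (q t)" using q(1) tS by (simp add: FL_solution_def)
  have "0 < q t 0 0" using less u0 by simp
  note derivs = solution_derivs(1,2)[OF q(1) tS this, unfolded at]
  show ?thesis
    by (rule energy_deriv[OF derivs phi_bound])
      (use less \<rho> coordinates(4)[OF state] state_tail_nonneg[OF state] in auto)
qed

text \<open>The confinement is assumed only strictly before \<open>T\<close>, so the bounds still
  hold at a first exit time; this is what closes the bootstrap below.\<close>

lemma solution_bound:
  assumes q: "solution S q" "{0..T} \<subseteq> S" and T: "0 \<le> T"
    and less: "\<And>t. 0 < t \<Longrightarrow> t < T \<Longrightarrow> 1 - q t 0 0 < w"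
  shows "tail (q T) 1 1 + tail (q T) 2 0 \<le> tail (q 0) 1 1 + tail (q 0) 2 0"
    and "energy (1 - q T 0 0) (tail (q T) 0 1) \<le> max (energy (1 - q 0 0 0) (tail (q 0) 0 1))
      (C * (tail (q 0) 1 1 + tail (q 0) 2 0)\<^sup>2)"
proof -
  have q00: "0 < q t 0 0" if "0 < t" "t < T" for t using less[OF that] u0 by simp
  have dec: "tail (q t) 1 1 + tail (q t) 2 0 \<le> tail (q 0) 1 1 + tail (q 0) 2 0" if "0 \<le> t" "t \<le> T" for t
  proof -
    have sub: "{0..t} \<subseteq> S" using q(2) that by auto
    show ?thesis
      using that q00 by (intro add_mono solution_decreasing[OF q(1) sub]) auto
  qed
  then show "tail (q T) 1 1 + tail (q T) 2 0 \<le> tail (q 0) 1 1 + tail (q 0) 2 0" using T by simp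
  show "energy (1 - q T 0 0) (tail (q T) 0 1) \<le> max (energy (1 - q 0 0 0) (tail (q 0) 0 1))
      (C * (tail (q 0) 1 1 + tail (q 0) 2 0)\<^sup>2)"
  proof (rule energy_bound[OF T])
    show "continuous_on {0..T} (\<lambda>t. 1 - q t 0 0)" "continuous_on {0..T} (\<lambda>t. tail (q t) 0 1)"
      by (rule continuous_on_subset[OF solution_continuous(2)[OF q(1)] q(2)]
            continuous_on_subset[OF solution_continuous(1)[OF q(1)] q(2)])+
  qed (use solution_energy_deriv[OF q] less dec in auto)
qed

abbreviation (input) p0 where "p0 \<equiv> three_point u0 v0"

lemma p0_dist:
  assumes "is_state q"
  shows "\<bar>(1 - q 0 0) - u0\<bar> \<le> l1_dist q p0" "\<bar>tail q 0 1 - v0\<bar> \<le> l1_dist q p0"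
    "tail q 1 1 + tail q 2 0 \<le> l1_dist q p0" "0 \<le> tail q 1 1 + tail q 2 0"
    "l1_dist q p0 \<le> 2 * \<bar>(1 - q 0 0) - u0\<bar> + 2 * \<bar>tail q 0 1 - v0\<bar> + 2 * (tail q 1 1 + tail q 2 0)"
  using l1_dist_three_point_bounds[OF assms, of v0 u0] v0 u0
    add_nonneg_nonneg[OF state_tail_nonneg[OF assms] state_tail_nonneg[OF assms]] by auto

lemma stays_close:
  assumes "0 < \<epsilon>"
  obtains \<delta> where "0 < \<delta>" "\<And>T q t. solution {0..<T} q \<Longrightarrow> l1_dist (q 0) p0 < \<delta> \<Longrightarrow> 0 \<le> t \<Longrightarrow> t < T \<Longrightarrow>
    l1_dist (q t) p0 < \<epsilon> \<and> 1 - q t 0 0 < w"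
proof -
  \<comment> \<open>The distance is at most twice the sum of three quantities below
    \<open>\<eta>\<close>, hence \<open>\<epsilon> / 6\<close>; with
    \<open>\<eta> \<le> w - u0\<close> a solution cannot reach \<open>u = w\<close>.\<close>
  define \<eta> where "\<eta> = min (\<epsilon> / 6) (w - u0)"
  have \<eta>: "0 < \<eta>" using assms u0 by (simp add: \<eta>_def)
  obtain \<delta> where \<delta>: "0 < \<delta>" "\<delta> \<le> \<eta>"
    "\<And>x y \<rho>. \<bar>x - u0\<bar> < \<delta> \<Longrightarrow> \<bar>y - v0\<bar> < \<delta> \<Longrightarrow> 0 \<le> \<rho> \<Longrightarrow> \<rho> < \<delta> \<Longrightarrow>
      max (energy x y) (C * \<rho>\<^sup>2) < threshold \<eta>"
    using small_initial[OF \<eta>] by blast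
  show ?thesis
  proof (rule that[OF \<delta>(1)])
    fix T q t assume q: "solution {0..<T} q" and init: "l1_dist (q 0) p0 < \<delta>" and t: "0 \<le> t" "t < T"
    have state: "is_state (q s)" if "0 \<le> s" "s < T" for s using q that by (simp add: FL_solution_def)
    have state0: "is_state (q 0)" using state t by simp
    have start: "max (energy (1 - q 0 0 0) (tail (q 0) 0 1))
      (C * (tail (q 0) 1 1 + tail (q 0) 2 0)\<^sup>2) < threshold \<eta>"
      using p0_dist[OF state0] init by (intro \<delta>(3)) linarith+
    have close: "\<bar>(1 - q s 0 0) - u0\<bar> < \<eta> \<and> \<bar>tail (q s) 0 1 - v0\<bar> < \<eta> \<and>
        tail (q s) 1 1 + tail (q s) 2 0 < \<eta>"
      if "0 \<le> s" "s < T" "\<And>t. 0 < t \<Longrightarrow> t < s \<Longrightarrow> 1 - q t 0 0 < w" for s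
    proof -
      have sub: "{0..s} \<subseteq> {0..<T}" using that by auto
      note bound = solution_bound[OF q sub that(1,3)]
      show ?thesis
        using energy_small[OF \<eta> order.strict_trans1[OF bound(2) start]] bound(1) p0_dist[OF state0] init \<delta>(2)
        by linarith
    qed
    have less: "1 - q s 0 0 < w" if s: "0 \<le> s" "s < T" for s
    proof (rule ccontr)
      assume *: "\<not> 1 - q s 0 0 < w"
      have "continuous_on {0..s} (\<lambda>t. 1 - q t 0 0)"
        using s by (intro continuous_on_subset[OF solution_continuous(2)[OF q]]) auto
      moreover have "1 - q 0 0 0 < w"
        using close[of 0] t by (simp add: \<eta>_def) linarith
      ultimately obtain r where r: "0 < r" "r \<le> s" "1 - q r 0 0 = w" "\<And>t. 0 \<le> t \<Longrightarrow> t < r \<Longrightarrow> 1 - q t 0 0 < w"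
        using first_exit[of s "\<lambda>t. 1 - q t 0 0" w] s * by auto
      then have "\<bar>(1 - q r 0 0) - u0\<bar> < \<eta>" using close[of r] s by auto
      moreover have "\<eta> \<le> w - u0" by (simp add: \<eta>_def)
      ultimately show False using r(3) by linarith
    qed
    have "l1_dist (q t) p0 < 6 * \<eta>"
      using close[OF t] less t p0_dist(5)[OF state[OF t]] by force
    moreover have "\<eta> \<le> \<epsilon> / 6" unfolding \<eta>_def by linarith
    ultimately show "l1_dist (q t) p0 < \<epsilon> \<and> 1 - q t 0 0 < w" using less[OF t] by simp
  qed
qed

lemma global_solution:
  obtains \<delta> where "0 < \<delta>" "\<And>q. is_state q \<Longrightarrow> l1_dist q p0 < \<delta> \<Longrightarrow> \<exists>r. solution {0..} r \<and> r 0 = q"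
proof -
  \<comment> \<open>With the decaying mass below \<open>\<eta>\<close> as well, the three terms
    guarantee in turn \<open>u < w\<close>, \<open>V > \<eta>\<close> and
    \<open>u - V > \<eta>\<close>: the truncation is inactive and the tails stay ordered.\<close>
  define \<eta> where "\<eta> = min (w - u0) (min (v0 / 2) ((u0 - v0) / 3))"
  have \<eta>: "0 < \<eta>" using u0 v0 by (simp add: \<eta>_def)
  have "\<eta> \<le> w - u0" "\<eta> \<le> v0 / 2" "\<eta> \<le> (u0 - v0) / 3"
    unfolding \<eta>_def by (meson min.cobounded1 min.cobounded2 order_trans)+
  then have \<eta>_le: "\<eta> \<le> w - u0" "2 * \<eta> \<le> v0" "3 * \<eta> \<le> u0 - v0" by (simp_all add: field_simps)
  obtain \<delta> where \<delta>: "0 < \<delta>" "\<delta> \<le> \<eta>"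
    "\<And>x y \<rho>. \<bar>x - u0\<bar> < \<delta> \<Longrightarrow> \<bar>y - v0\<bar> < \<delta> \<Longrightarrow> 0 \<le> \<rho> \<Longrightarrow> \<rho> < \<delta> \<Longrightarrow>
      max (energy x y) (C * \<rho>\<^sup>2) < threshold \<eta>"
    using small_initial[OF \<eta>] by blast
  show ?thesis
  proof (rule that[OF \<delta>(1)])
    fix q assume q: "is_state q" "l1_dist q p0 < \<delta>"
    have w: "0 \<le> w" "w \<le> 1" using u0 by auto
    obtain u V where init: "u 0 = 1 - q 0 0" "V 0 = tail q 0 1"
      and u: "\<And>t. 0 \<le> t \<Longrightarrow> (u has_real_derivative lam - \<mu>\<^sub>1 * u t + (\<mu>\<^sub>1 - \<mu>\<^sub>2) * V t
        + (\<mu>\<^sub>1 * decay q 2 0 t + \<mu>\<^sub>2 * decay q 1 1 t)) (at t within {0..})"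
      and V: "\<And>t. 0 \<le> t \<Longrightarrow> (V has_real_derivative lam * max 0 (min w (u t)) ^ d - \<mu>\<^sub>2 * V t
        + \<mu>\<^sub>2 * decay q 1 1 t) (at t within {0..})"
      using planar_solution[OF q(1) w] by blast
    define \<rho> where "\<rho> = tail q 1 1 + tail q 2 0"
    have \<rho>: "0 \<le> \<rho>" "\<rho> < \<delta>" using p0_dist[OF q(1)] q(2) by (auto simp: \<rho>_def)
    have decay: "0 \<le> decay q 1 1 t" "0 \<le> decay q 2 0 t" "decay q 1 1 t + decay q 2 0 t \<le> \<rho>" if "0 \<le> t" for t
      using decay_bounds[OF q(1) that] by (auto simp: \<rho>_def intro: add_mono)
    have "max (energy (u 0) (V 0)) (C * \<rho>\<^sup>2) < threshold \<eta>"
      using p0_dist[OF q(1)] q(2) \<rho> by (intro \<delta>(3)) (auto simp: init)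
    moreover have "energy (u T) (V T) \<le> max (energy (u 0) (V 0)) (C * \<rho>\<^sup>2)" if "0 \<le> T" for T
    proof (rule energy_bound[OF that])
      show "continuous_on {0..T} u" "continuous_on {0..T} V"
        using u V by (auto intro!: continuous_on_subset[OF DERIV_continuous_on[of "{0..}"]])
      fix t assume t: "0 < t" "t < T"
      then have t0: "0 \<le> t" by simp
      have at: "at t within {0..} = at t" by (rule at_within_interval[OF t]) auto
      \<comment> \<open>Truncation is nonexpansive and fixes \<open>u0\<close>, so the energy
        estimate holds for the auxiliary system at all times, before it is known that the truncation
        is inactive.\<close>
      have "\<bar>max 0 (min w (u t)) ^ d - u0 ^ d\<bar> \<le> real d * w ^ (d - 1) * \<bar>max 0 (min w (u t)) - u0\<bar>"
        using u0 by (intro phi_bound) auto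
      also have "\<dots> \<le> real d * w ^ (d - 1) * \<bar>u t - u0\<bar>"
        using u0 by (intro mult_left_mono) auto
      finally show "\<exists>D. ((\<lambda>t. energy (u t) (V t)) has_real_derivative D) (at t)
          \<and> D \<le> k * (C * \<rho>\<^sup>2 - energy (u t) (V t))"
        using t by (intro energy_deriv[OF u[OF t0, unfolded at] V[OF t0, unfolded at]] decay) auto
    qed
    ultimately have close: "\<bar>u t - u0\<bar> < \<eta>" "\<bar>V t - v0\<bar> < \<eta>" if "0 \<le> t" for t
      using energy_small[OF \<eta>] that by (meson order.strict_trans1)+
    have cut: "max 0 (min w (u t)) = u t" if "0 \<le> t" for t
      using close(1)[OF that] v0 \<eta>_le by linarith
    have range: "0 \<le> u t \<and> u t < 1 \<and> decay q 1 1 t \<le> V t \<and> decay q 2 0 t \<le> u t - V t" if "t \<in> {0..}" for t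
    proof -
      have t: "0 \<le> t" using that by simp
      show ?thesis using \<eta>_le close[OF t] decay[OF t] \<rho> \<delta>(2) u0 v0 \<eta> by linarith
    qed
    show "\<exists>r. solution {0..} r \<and> r 0 = q"
    proof (rule assemble_solution[OF q(1) order_refl _ init range])
      fix t :: real assume t: "t \<in> {0..}"
      then show "(u has_real_derivative lam - \<mu>\<^sub>1 * u t + (\<mu>\<^sub>1 - \<mu>\<^sub>2) * V t
          + (\<mu>\<^sub>1 * decay q 2 0 t + \<mu>\<^sub>2 * decay q 1 1 t)) (at t within {0..})"
        using u by simp
      show "(V has_real_derivative lam * u t ^ d - \<mu>\<^sub>2 * V t + \<mu>\<^sub>2 * decay q 1 1 t) (at t within {0..})"
        using V[of t] cut[of t] t by simp
    qed auto
  qed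
qed

text \<open>The energy relaxes towards a level proportional to the squared decaying mass, and that
  mass tends to 0.\<close>

lemma solution_converges:
  assumes q: "solution {0..} q" and less: "\<And>t. 0 \<le> t \<Longrightarrow> 1 - q t 0 0 < w"
  shows "((\<lambda>t. l1_dist (q t) p0) \<longlongrightarrow> 0) at_top"
proof -
  have state: "is_state (q t)" if "0 \<le> t" for t using q that by (simp add: FL_solution_def)
  have q00: "0 < q t 0 0" if "0 \<le> t" for t using less[OF that] u0 by simp
  define \<rho> where "\<rho> = (\<lambda>t. tail (q t) 1 1 + tail (q t) 2 0)"
  have \<rho>_nonneg: "0 \<le> \<rho> t" if "0 \<le> t" for t using p0_dist(4)[OF state[OF that]] by (simp add: \<rho>_def)
  have \<rho>: "\<forall>\<^sub>F t in at_top. \<rho> t < e" if "0 < e" for e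
  proof -
    have "0 < e / 2" using that by simp
    note solution_tail_tendsto_0[OF q q00 _ this]
    from this[of 1 1] this[of 2 0] have "\<forall>\<^sub>F t in at_top. tail (q t) 1 1 < e / 2"
      "\<forall>\<^sub>F t in at_top. tail (q t) 2 0 < e / 2" by simp_all
    then show ?thesis by eventually_elim (simp add: \<rho>_def)
  qed
  have energy: "\<forall>\<^sub>F t in at_top. energy (1 - q t 0 0) (tail (q t) 0 1) < e" if "0 < e" for e
  proof (rule relaxation_eventually_less[OF kC(1), of 0 _ "\<lambda>t. C * (\<rho> t)\<^sup>2" 0])
    show "\<exists>D. ((\<lambda>t. energy (1 - q t 0 0) (tail (q t) 0 1)) has_real_derivative D) (at t)
        \<and> D \<le> k * (C * (\<rho> t)\<^sup>2 - energy (1 - q t 0 0) (tail (q t) 0 1))" if "0 < t" for t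
      using that less by (intro solution_energy_deriv[OF q, of "t + 1"]) (auto simp: \<rho>_def)
    show "\<forall>\<^sub>F t in at_top. C * (\<rho> t)\<^sup>2 < e" if "0 < e" for e
    proof -
      \<comment> \<open>\<open>C + 1\<close> instead of \<open>C\<close>, because \<open>C\<close>
        may be 0.\<close>
      define s where "s = sqrt (e / (C + 1))"
      have s: "0 < s" "(C + 1) * s\<^sup>2 = e" using that kC by (auto simp: s_def)
      show ?thesis using \<rho>[OF s(1)] eventually_ge_at_top[of 0]
      proof eventually_elim
        case (elim t)
        have "C * (\<rho> t)\<^sup>2 \<le> C * s\<^sup>2" using elim \<rho>_nonneg kC by (intro mult_left_mono power_mono) auto
        moreover have "0 < s\<^sup>2" using s by simp
        moreover have "(C + 1) * s\<^sup>2 = C * s\<^sup>2 + s\<^sup>2" by (simp add: distrib_right)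
        ultimately show ?case using s(2) by linarith
      qed
    qed
  qed (use that in auto)
  show ?thesis
  proof (rule order_tendstoI)
    fix e :: real assume "e < 0"
    have nonneg: "0 \<le> l1_dist (q t) p0" if "0 \<le> t" for t
      using p0_dist(1)[OF state[OF that]] by linarith
    show "\<forall>\<^sub>F t in at_top. e < l1_dist (q t) p0"
      using eventually_ge_at_top[of 0] by eventually_elim (use nonneg \<open>e < 0\<close> in force)
  next
    fix e :: real assume "0 < e"
    define \<eta> where "\<eta> = e / 6"
    have \<eta>: "0 < \<eta>" using \<open>0 < e\<close> by (simp add: \<eta>_def)
    show "\<forall>\<^sub>F t in at_top. l1_dist (q t) p0 < e"
      using energy[OF threshold_pos[OF \<eta>]] \<rho>[OF \<eta>] eventually_ge_at_top[of 0]
    proof eventually_elim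
      case (elim t)
      show ?case
        using energy_small[OF \<eta> elim(1)] elim(2) p0_dist(5)[OF state[OF elim(3)]]
        unfolding \<rho>_def \<eta>_def by argo
    qed
  qed
qed

lemma locally_stable: "FL_locally_stable lam \<mu>\<^sub>1 \<mu>\<^sub>2 d p0"
proof -
  obtain \<delta>1 where \<delta>1: "0 < \<delta>1" "\<And>q. is_state q \<Longrightarrow> l1_dist q p0 < \<delta>1 \<Longrightarrow> \<exists>r. solution {0..} r \<and> r 0 = q"
    using global_solution by blast
  \<comment> \<open>The distance 1 is arbitrary; the point is confinement to \<open>u < w\<close>
    for all times.\<close>
  obtain \<delta>2 where \<delta>2: "0 < \<delta>2" "\<And>T q t. solution {0..<T} q \<Longrightarrow> l1_dist (q 0) p0 < \<delta>2 \<Longrightarrow> 0 \<le> t \<Longrightarrow> t < T \<Longrightarrow>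
    l1_dist (q t) p0 < 1 \<and> 1 - q t 0 0 < w"
    using stays_close[of 1] by (metis zero_less_one)
  have converges: "((\<lambda>t. l1_dist (q t) p0) \<longlongrightarrow> 0) at_top"
    if q: "solution {0..} q" "l1_dist (q 0) p0 < \<delta>2" for q
  proof (rule solution_converges[OF q(1)])
    fix t :: real assume "0 \<le> t"
    moreover have "solution {0..<t + 1} q" by (rule solution_subset[OF q(1)]) auto
    ultimately show "1 - q t 0 0 < w" using \<delta>2(2)[of "t + 1" q t] q(2) by simp
  qed
  show ?thesis
    unfolding FL_locally_stable_def
  proof (intro conjI allI impI)
    fix \<epsilon> :: real assume "0 < \<epsilon>"
    then obtain \<delta> where "0 < \<delta>" "\<And>T q t. solution {0..<T} q \<Longrightarrow> l1_dist (q 0) p0 < \<delta> \<Longrightarrow> 0 \<le> t \<Longrightarrow> t < T \<Longrightarrow>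
        l1_dist (q t) p0 < \<epsilon> \<and> 1 - q t 0 0 < w"
      using stays_close by metis
    then show "\<exists>\<delta>>0. \<forall>T>0. \<forall>q. solution {0..<T} q \<and> l1_dist (q 0) p0 < \<delta> \<longrightarrow>
        (\<forall>t\<in>{0..<T}. l1_dist (q t) p0 < \<epsilon>)"
      by (intro exI[of _ \<delta>]) auto
  next
    show "\<exists>\<delta>>0. \<forall>q0. is_state q0 \<and> l1_dist q0 p0 < \<delta> \<longrightarrow>
        (\<exists>q. solution {0..} q \<and> q 0 = q0) \<and>
        (\<forall>q. solution {0..} q \<and> q 0 = q0 \<longrightarrow> ((\<lambda>t. l1_dist (q t) p0) \<longlongrightarrow> 0) at_top)"
      using \<delta>1 \<delta>2(1) converges by (intro exI[of _ "min \<delta>1 \<delta>2"]) auto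
  qed
qed

end

context FL
begin

text \<open>Clearing denominators turns the slope of the polynomial into the determinant
  \<open>\<mu>\<^sub>1 * \<mu>\<^sub>2 - (\<mu>\<^sub>1 - \<mu>\<^sub>2) * c\<close> with
  \<open>c\<close> the slope of \<open>lam * u ^ d\<close>: the form needed by the Lyapunov
  inequality and by the eigenvalue.\<close>

lemma derivative_sign:
  "lam * (1 / \<mu>\<^sub>2 - 1 / \<mu>\<^sub>1) * (real d * x) < 1 \<longleftrightarrow> (\<mu>\<^sub>1 - \<mu>\<^sub>2) * (lam * (real d * x)) < \<mu>\<^sub>1 * \<mu>\<^sub>2"
  "1 < lam * (1 / \<mu>\<^sub>2 - 1 / \<mu>\<^sub>1) * (real d * x) \<longleftrightarrow> \<mu>\<^sub>1 * \<mu>\<^sub>2 < (\<mu>\<^sub>1 - \<mu>\<^sub>2) * (lam * (real d * x))"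
proof -
  have "lam * (1 / \<mu>\<^sub>2 - 1 / \<mu>\<^sub>1) * (real d * x) = (\<mu>\<^sub>1 - \<mu>\<^sub>2) * (lam * (real d * x)) / (\<mu>\<^sub>1 * \<mu>\<^sub>2)"
    using pos by (simp add: field_simps)
  then show "lam * (1 / \<mu>\<^sub>2 - 1 / \<mu>\<^sub>1) * (real d * x) < 1 \<longleftrightarrow> (\<mu>\<^sub>1 - \<mu>\<^sub>2) * (lam * (real d * x)) < \<mu>\<^sub>1 * \<mu>\<^sub>2"
    "1 < lam * (1 / \<mu>\<^sub>2 - 1 / \<mu>\<^sub>1) * (real d * x) \<longleftrightarrow> \<mu>\<^sub>1 * \<mu>\<^sub>2 < (\<mu>\<^sub>1 - \<mu>\<^sub>2) * (lam * (real d * x))"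
    using pos by (simp_all add: divide_less_eq less_divide_eq)
qed

lemma lower_root_stable:
  assumes "0 < u" "u < 1" "root_eqn u = 0"
    and "lam * (1 / \<mu>\<^sub>2 - 1 / \<mu>\<^sub>1) * (real d * u ^ (d - 1)) < 1"
  shows "FL_locally_stable lam \<mu>\<^sub>1 \<mu>\<^sub>2 d (three_point u (lam / \<mu>\<^sub>2 * u ^ d))"
proof -
  \<comment> \<open>The strict determinant condition at \<open>u\<close> persists for some
    \<open>w\<close> slightly to the right, by continuity.\<close>
  have "((\<lambda>w. (\<mu>\<^sub>1 - \<mu>\<^sub>2) * (lam * (real d * w ^ (d - 1)))) \<longlongrightarrow>
      (\<mu>\<^sub>1 - \<mu>\<^sub>2) * (lam * (real d * u ^ (d - 1)))) (at_right u)"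
    by (intro tendsto_intros)
  then have "\<forall>\<^sub>F w in at_right u. (\<mu>\<^sub>1 - \<mu>\<^sub>2) * (lam * (real d * w ^ (d - 1))) < \<mu>\<^sub>1 * \<mu>\<^sub>2"
    using assms(4) unfolding derivative_sign by (rule order_tendstoD)
  moreover have "\<forall>\<^sub>F w in at_right u. w \<in> {u<..<1}" by (rule eventually_at_right_real[OF assms(2)])
  ultimately have "\<forall>\<^sub>F w in at_right u. (\<mu>\<^sub>1 - \<mu>\<^sub>2) * (lam * (real d * w ^ (d - 1))) < \<mu>\<^sub>1 * \<mu>\<^sub>2 \<and> w \<in> {u<..<1}"
    by (rule eventually_conj)
  from eventually_happens'[OF trivial_limit_at_right_real this]
  obtain w where w: "(\<mu>\<^sub>1 - \<mu>\<^sub>2) * (lam * (real d * w ^ (d - 1))) < \<mu>\<^sub>1 * \<mu>\<^sub>2" "u < w" "w < 1"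
    by auto
  define slope where "slope = lam * (real d * w ^ (d - 1))"
  have "0 < slope" using pos params w assms by (simp add: slope_def)
  then obtain k C where "0 < k" "0 \<le> C"
    "\<And>x y n g h \<rho>. \<bar>n\<bar> \<le> slope * \<bar>x\<bar> \<Longrightarrow> \<bar>g\<bar> \<le> \<mu>\<^sub>1 * \<rho> \<Longrightarrow> \<bar>h\<bar> \<le> \<mu>\<^sub>2 * \<rho> \<Longrightarrow>
      2 * slope * x * (- \<mu>\<^sub>1 * x + (\<mu>\<^sub>1 - \<mu>\<^sub>2) * y + g) + 2 * (\<mu>\<^sub>1 - \<mu>\<^sub>2) * y * (n - \<mu>\<^sub>2 * y + h)
        \<le> k * (C * \<rho>\<^sup>2 - (slope * x\<^sup>2 + (\<mu>\<^sub>1 - \<mu>\<^sub>2) * y\<^sup>2))"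
    using lyapunov_inequality[of \<mu>\<^sub>2 \<mu>\<^sub>1 "\<mu>\<^sub>1 - \<mu>\<^sub>2" slope] pos w by (auto simp: slope_def)
  then interpret FL_lower_root lam \<mu>\<^sub>1 \<mu>\<^sub>2 d u w k C slope "lam / \<mu>\<^sub>2 * u ^ d"
    using assms(1,3) w(2,3) slope_def by unfold_locales auto
  show ?thesis by (rule locally_stable)
qed

section \<open>Instability\<close>

lemma upper_root_unstable:
  assumes u0: "0 < u0" "u0 < 1" "root_eqn u0 = 0"
    and steep: "1 < lam * (1 / \<mu>\<^sub>2 - 1 / \<mu>\<^sub>1) * (real d * u0 ^ (d - 1))"
  shows "FL_unstable lam \<mu>\<^sub>1 \<mu>\<^sub>2 d (three_point u0 (lam / \<mu>\<^sub>2 * u0 ^ d))"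
proof -
  define v0 where "v0 = lam / \<mu>\<^sub>2 * u0 ^ d"
  define c where "c = lam * (real d * u0 ^ (d - 1))"
  define b where "b = \<mu>\<^sub>1 - \<mu>\<^sub>2"
  have v0: "0 < v0" "v0 < u0" using root_bounds[OF u0] by (simp_all add: v0_def)
  note eq = equilibrium_eqns[OF u0(3), folded v0_def]
  have c: "0 < c" using pos params u0 by (simp add: c_def)
  have bc: "\<mu>\<^sub>1 * \<mu>\<^sub>2 < b * c" using steep unfolding derivative_sign by (simp add: b_def c_def)
  \<comment> \<open>\<open>\<sigma>\<close> is the unstable eigenvalue of the linearization and \<open>(c, l)\<close> a left eigenvector.\<close>
  define R where "R = sqrt ((\<mu>\<^sub>1 - \<mu>\<^sub>2)\<^sup>2 + 4 * (b * c))"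
  define \<sigma> where "\<sigma> = (R - (\<mu>\<^sub>1 + \<mu>\<^sub>2)) / 2"
  define l where "l = \<sigma> + \<mu>\<^sub>1"
  have "(\<mu>\<^sub>1 + \<mu>\<^sub>2)\<^sup>2 < (\<mu>\<^sub>1 - \<mu>\<^sub>2)\<^sup>2 + 4 * (b * c)"
    using bc by (simp add: power2_eq_square algebra_simps)
  then have "0 < \<sigma>" unfolding \<sigma>_def R_def by (simp add: real_less_rsqrt)
  then have l: "0 < l" using pos by (simp add: l_def)
  have "R\<^sup>2 = (\<mu>\<^sub>1 - \<mu>\<^sub>2)\<^sup>2 + 4 * (b * c)" using pos c by (simp add: R_def b_def)
  then have eigen: "l * (\<sigma> + \<mu>\<^sub>2) = b * c"
    unfolding l_def \<sigma>_def by (simp add: power2_eq_square field_simps)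
  \<comment> \<open>A deviation \<open>g \<le> 2 * \<epsilon>\<close> keeps \<open>u < 1\<close>,
    \<open>V > 0\<close> and \<open>u > V\<close>. At \<open>g = 2 * \<epsilon>\<close> the larger
    of the two planar deviations is at least \<open>\<epsilon>\<close>, and so is the
    distance.\<close>
  define \<epsilon> where "\<epsilon> = min (1 - u0) (min v0 (u0 - v0)) / 4"
  have \<epsilon>: "0 < \<epsilon>" using u0 v0 by (simp add: \<epsilon>_def)
  have "4 * \<epsilon> \<le> 1 - u0 \<and> 4 * \<epsilon> \<le> v0 \<and> 4 * \<epsilon> \<le> u0 - v0" unfolding \<epsilon>_def by (simp add: min_le_iff_disj)
  then have margin: "2 * \<epsilon> < 1 - u0" "2 * \<epsilon> < v0" "2 * \<epsilon> < u0 - v0" using \<epsilon> by linarith+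
  have "\<exists>T>0. \<exists>q. solution {0..T} q \<and> l1_dist (q 0) (three_point u0 v0) < \<delta> \<and>
      \<epsilon> \<le> l1_dist (q T) (three_point u0 v0)" if "0 < \<delta>" for \<delta>
  proof -
    \<comment> \<open>Both coordinates are raised by \<open>s\<close>, a direction in which the
      positive eigenvector is positive; the distance from the equilibrium is then at most
      \<open>4 * s\<close>.\<close>
    define s where "s = min \<delta> \<epsilon> / 8"
    have s: "0 < s" "4 * s < \<delta>" "4 * s < \<epsilon>" using \<epsilon> that by (auto simp: s_def min_def)
    define q where "q = three_point (u0 + s) (v0 + s)"
    have state: "is_state q"
      unfolding q_def using u0 v0 s margin by (intro three_point_state) linarith+
    have tails: "tail q 1 1 = 0" "tail q 2 0 = 0" unfolding q_def by (rule three_point_tail)+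
    have q: "1 - q 0 0 = u0 + s" "tail q 0 1 = v0 + s"
      using coordinates(1)[OF state] tails by (simp_all add: q_def)
    have start: "l1_dist q (three_point u0 v0) < \<delta>"
      using l1_dist_three_point_bounds(4)[OF state, of v0 u0] u0 v0 s q tails by simp
    obtain u V where init: "u 0 = 1 - q 0 0" "V 0 = tail q 0 1"
      and u: "\<And>t. 0 \<le> t \<Longrightarrow> (u has_real_derivative lam - \<mu>\<^sub>1 * u t + (\<mu>\<^sub>1 - \<mu>\<^sub>2) * V t
        + (\<mu>\<^sub>1 * decay q 2 0 t + \<mu>\<^sub>2 * decay q 1 1 t)) (at t within {0..})"
      and V: "\<And>t. 0 \<le> t \<Longrightarrow> (V has_real_derivative lam * max 0 (min 1 (u t)) ^ d - \<mu>\<^sub>2 * V t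
        + \<mu>\<^sub>2 * decay q 1 1 t) (at t within {0..})"
      using planar_solution[OF state zero_le_one order_refl] by blast
    have decay: "decay q 1 1 t = 0" "decay q 2 0 t = 0" if "0 \<le> t" for t
      using decay_bounds(1,2)[OF state that, of 1 1] decay_bounds(1,2)[OF state that, of 2 0] tails by simp_all
    define g where "g = (\<lambda>t. \<bar>u t - u0\<bar> + \<bar>V t - v0\<bar>)"
    have cont: "continuous_on {0..T} u" "continuous_on {0..T} V" for T
      using u V by (auto intro!: continuous_on_subset[OF DERIV_continuous_on[of "{0..}"]])
    have g0: "g 0 < 2 * \<epsilon>" using init q s by (simp add: g_def)
    have range: "0 \<le> u t" "u t < 1" "0 \<le> V t" "0 \<le> u t - V t" if "g t \<le> 2 * \<epsilon>" for t
      using that margin v0 unfolding g_def by linarith+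
    have "\<exists>T\<ge>0. 2 * \<epsilon> \<le> g T"
    proof (rule ccontr)
      assume "\<not> (\<exists>T\<ge>0. 2 * \<epsilon> \<le> g T)"
      then have g: "g t \<le> 2 * \<epsilon>" if "0 \<le> t" for t using that by force
      define \<Lambda> where "\<Lambda> = (\<lambda>t. c * (u t - u0) + l * (V t - v0))"
      \<comment> \<open>By \<open>exp x \<ge> 1 + x\<close>, the growing functional exceeds at this
        time the bound that \<open>g \<le> 2 * \<epsilon>\<close> imposes on it.\<close>
      define T where "T = 2 * \<epsilon> / (s * \<sigma>)"
      have T: "0 \<le> T" using \<epsilon> s \<open>0 < \<sigma>\<close> by (simp add: T_def)
      have "- \<Lambda> T - 0 \<le> (- \<Lambda> 0 - 0) * exp (- (- \<sigma>) * (T - 0))"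
      proof (rule gronwall[OF T])
        show "continuous_on {0..T} (\<lambda>t. - \<Lambda> t)" unfolding \<Lambda>_def by (intro continuous_intros cont)
        fix t assume t: "0 < t" "t < T"
        then have t0: "0 \<le> t" by simp
        have at: "at t within {0..} = at t" by (rule at_within_interval[OF t]) auto
        note r = range[OF g[OF t0]]
        define D where "D = c * (lam - \<mu>\<^sub>1 * u t + b * V t) + l * (lam * u t ^ d - \<mu>\<^sub>2 * V t)"
        have u': "(u has_real_derivative lam - \<mu>\<^sub>1 * u t + b * V t) (at t)"
          using u[OF t0] by (simp add: at decay[OF t0, simplified] b_def)
        have V': "(V has_real_derivative lam * u t ^ d - \<mu>\<^sub>2 * V t) (at t)"
          using V[OF t0] r by (simp add: at decay[OF t0, simplified])
        have "((\<lambda>t. - \<Lambda> t) has_real_derivative - D) (at t)"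
          unfolding \<Lambda>_def D_def by (auto intro!: derivative_eq_intros u' V')
        moreover have "\<sigma> * \<Lambda> t \<le> D"
        proof -
          \<comment> \<open>Convexity puts the nonlinear term above its tangent, and
            \<open>l > 0\<close> keeps the sign: the nonlinear correction only helps the functional
            grow.\<close>
          have "lam * (u0 ^ d + real d * u0 ^ (d - 1) * (u t - u0)) \<le> lam * u t ^ d"
            using power_ge_tangent[of "u t" u0 d] r u0 pos by (intro mult_left_mono) auto
          then have "\<mu>\<^sub>2 * v0 + c * (u t - u0) \<le> lam * u t ^ d"
            unfolding eq(1)[symmetric] c_def by (simp add: algebra_simps)
          then have "l * (\<mu>\<^sub>2 * v0 + c * (u t - u0)) \<le> l * (lam * u t ^ d)" using l by simp
          moreover have "D = c * (- \<mu>\<^sub>1 * (u t - u0)) + (b * c) * (V t - v0) + l * (lam * u t ^ d) - l * \<mu>\<^sub>2 * V t"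
          proof -
            have u_eq: "lam - \<mu>\<^sub>1 * u t + b * V t = - \<mu>\<^sub>1 * (u t - u0) + b * (V t - v0)"
              using eq(2) by (simp add: b_def algebra_simps)
            show ?thesis unfolding D_def u_eq by (simp add: algebra_simps)
          qed
          moreover have "\<sigma> * \<Lambda> t = c * (- \<mu>\<^sub>1 * (u t - u0)) + l * (\<sigma> + \<mu>\<^sub>2) * (V t - v0)
              + l * (\<mu>\<^sub>2 * v0 + c * (u t - u0)) - l * \<mu>\<^sub>2 * V t"
            unfolding \<Lambda>_def l_def by (simp add: algebra_simps)
          ultimately show ?thesis unfolding eigen by linarith
        qed
        ultimately show "\<exists>D. ((\<lambda>t. - \<Lambda> t) has_real_derivative D) (at t) \<and> D \<le> - \<sigma> * (0 - - \<Lambda> t)"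
          by (intro exI[of _ "- D"]) simp
      qed
      then have "\<Lambda> 0 * exp (\<sigma> * T) \<le> \<Lambda> T" by simp
      moreover have "\<Lambda> 0 = (c + l) * s" using init q by (simp add: \<Lambda>_def algebra_simps)
      moreover have "\<Lambda> T \<le> (c + l) * (2 * \<epsilon>)"
      proof -
        have "u T - u0 \<le> 2 * \<epsilon>" "V T - v0 \<le> 2 * \<epsilon>" using g[OF T] unfolding g_def by linarith+
        then show ?thesis unfolding \<Lambda>_def distrib_right using c l by (intro add_mono mult_left_mono) auto
      qed
      ultimately have "(c + l) * (s * exp (\<sigma> * T)) \<le> (c + l) * (2 * \<epsilon>)" by (simp add: mult.assoc)
      then have "s * exp (\<sigma> * T) \<le> 2 * \<epsilon>" using c l by simp
      moreover have "s * (1 + \<sigma> * T) \<le> s * exp (\<sigma> * T)" using s by (intro mult_left_mono exp_ge_add_one_self) auto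
      moreover have "s * (1 + \<sigma> * T) = s + 2 * \<epsilon>" using s \<open>0 < \<sigma>\<close> by (simp add: T_def field_simps)
      ultimately show False using s by linarith
    qed
    then obtain T' where "0 \<le> T'" "2 * \<epsilon> \<le> g T'" by blast
    moreover have "continuous_on {0..T'} g" unfolding g_def by (intro continuous_intros cont)
    ultimately obtain T where T: "0 < T" "g T = 2 * \<epsilon>" "\<And>t. 0 \<le> t \<Longrightarrow> t < T \<Longrightarrow> g t < 2 * \<epsilon>"
      using first_exit[of T' g "2 * \<epsilon>"] g0 by metis
    have g: "g t \<le> 2 * \<epsilon>" if "t \<in> {0..T}" for t
      using T(2) T(3)[of t] that by (cases "t = T") auto
    have sub: "{0..T} \<subseteq> {0..}" by auto
    have zero: "0 \<in> {0..T}" using T by simp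
    obtain r where r: "solution {0..T} r" "r 0 = q"
      "\<And>t. t \<in> {0..T} \<Longrightarrow> 1 - r t 0 0 = u t \<and> tail (r t) 0 1 = V t"
    proof (rule assemble_solution[where u = u and V = V, OF state sub zero init])
      fix t assume t: "t \<in> {0..T}"
      then have t0: "0 \<le> t" by simp
      note rt = range[OF g[OF t]]
      show "0 \<le> u t \<and> u t < 1 \<and> decay q 1 1 t \<le> V t \<and> decay q 2 0 t \<le> u t - V t"
        unfolding decay[OF t0] using rt by blast
      show "(u has_real_derivative lam - \<mu>\<^sub>1 * u t + (\<mu>\<^sub>1 - \<mu>\<^sub>2) * V t
          + (\<mu>\<^sub>1 * decay q 2 0 t + \<mu>\<^sub>2 * decay q 1 1 t)) (at t within {0..T})"
        using u[OF t0] sub by (rule has_field_derivative_subset)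
      have "max 0 (min 1 (u t)) = u t" using rt by simp
      then show "(V has_real_derivative lam * u t ^ d - \<mu>\<^sub>2 * V t + \<mu>\<^sub>2 * decay q 1 1 t) (at t within {0..T})"
        using has_field_derivative_subset[OF V[OF t0] sub] by simp
    qed blast
    have stateT: "is_state (r T)" using r(1) T by (simp add: FL_solution_def)
    have "\<epsilon> \<le> l1_dist (r T) (three_point u0 v0)"
      using l1_dist_three_point_bounds(1,2)[OF stateT, of v0 u0] u0 v0 r(3)[of T] T(1,2)
      by (simp add: g_def)
    then show ?thesis using r start T(1) by blast
  qed
  then show ?thesis
    unfolding FL_unstable_def v0_def[symmetric] using \<epsilon> by blast
qed

end

theorem theorem4p2:
  fixes lam \<mu>\<^sub>1 \<mu>\<^sub>2 :: real and d\<^sub>1 :: nat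
  assumes "\<mu>\<^sub>1 > lam" and "lam > \<mu>\<^sub>2" and "\<mu>\<^sub>2 > 0"
    and "d\<^sub>1 \<ge> d1_star lam \<mu>\<^sub>1 \<mu>\<^sub>2"
  shows "\<exists>p r. p \<noteq> r \<and>
    {q. FL_fixed_point lam \<mu>\<^sub>1 \<mu>\<^sub>2 d\<^sub>1 q \<and> q 0 0 > 0} = {p, r} \<and>
    (\<forall>q\<in>{p, r}. q 0 0 + q 0 1 + q 1 0 = 1) \<and>
    FL_locally_stable lam \<mu>\<^sub>1 \<mu>\<^sub>2 d\<^sub>1 p \<and>
    FL_unstable lam \<mu>\<^sub>1 \<mu>\<^sub>2 d\<^sub>1 r"
proof -
  have "2 \<le> d\<^sub>1" using d1_star_spec(1)[OF assms(1-3)] assms(4) by simp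
  then interpret FL lam \<mu>\<^sub>1 \<mu>\<^sub>2 d\<^sub>1 using assms by unfold_locales auto
  obtain u v where uv: "0 < u" "u < v" "v < 1"
    and roots: "\<And>y. 0 \<le> y \<Longrightarrow> y < 1 \<Longrightarrow> root_eqn y = 0 \<longleftrightarrow> y = u \<or> y = v"
    and signs: "lam * (1 / \<mu>\<^sub>2 - 1 / \<mu>\<^sub>1) * (real d\<^sub>1 * u ^ (d\<^sub>1 - 1)) < 1"
      "lam * (1 / \<mu>\<^sub>2 - 1 / \<mu>\<^sub>1) * (real d\<^sub>1 * v ^ (d\<^sub>1 - 1)) > 1"
    using fixpoint_eqn_roots[OF assms] by blast
  define p where "p = (\<lambda>y. three_point y (lam / \<mu>\<^sub>2 * y ^ d\<^sub>1))"
  have root: "root_eqn u = 0" "root_eqn v = 0" using roots uv by auto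
  have "p u 0 0 \<noteq> p v 0 0" using uv by (simp add: p_def)
  then have "p u \<noteq> p v" by metis
  moreover have "{q. FL_fixed_point lam \<mu>\<^sub>1 \<mu>\<^sub>2 d\<^sub>1 q \<and> q 0 0 > 0} = {p u, p v}"
  proof -
    have "0 \<le> u \<and> u < 1" "0 \<le> v \<and> v < 1" using uv by auto
    then have "(\<exists>y. 0 \<le> y \<and> y < 1 \<and> root_eqn y = 0 \<and> q = p y) \<longleftrightarrow> q = p u \<or> q = p v" for q
      using roots by blast
    then show ?thesis unfolding fixed_point_iff p_def by blast
  qed
  moreover have "\<forall>q\<in>{p u, p v}. q 0 0 + q 0 1 + q 1 0 = 1" by (simp add: p_def)
  moreover have "FL_locally_stable lam \<mu>\<^sub>1 \<mu>\<^sub>2 d\<^sub>1 (p u)"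
    unfolding p_def using uv root signs by (intro lower_root_stable) auto
  moreover have "FL_unstable lam \<mu>\<^sub>1 \<mu>\<^sub>2 d\<^sub>1 (p v)"
    unfolding p_def using uv root signs by (intro upper_root_unstable) auto
  ultimately show ?thesis by blast
qed

end
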